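(* For every integer $k\geq 3$, the set $\Pi^{(k)}=\{\pi(F): F\text{ is a }k\text{-graph}\}$ of Turán densities of $k$-uniform hypergraphs has an accumulation point in $[0,1)$. Moreover, $1/2$ is an accumulation point of $\Pi^{(3)}$.
   Context: For $k\in\mathbb{N}$, a $k$-uniform hypergraph (or $k$-graph) $H=(V,E)$ consists of a (finite) vertex set $V$ and an edge set $E\subseteq V^{(k)}=\{e\subseteq V: |e|=k\}$. A $k$-graph $H$ contains a copy of a $k$-graph $F$ if there is an injective map $V(F)\to V(H)$ sending every edge of $F$ to an edge of $H$ (i.e. $F$ is isomorphic to a not necessarily induced subhypergraph of $H$). Given $n\in\mathbb{N}$ and a $k$-graph $F$, the extremal number $\mathrm{ex}(n,F)$ is the maximum number of edges in a $k$-graph with $n$ vertices that does not contain a copy of $F$. The Turán density of $F$ is $$\pi(F)=\lim_{n\to\infty}\frac{\mathrm{ex}(n,F)}{\binom{n}{k}},$$ where the limit is known to exist. A real number $x$ is an accumulation point of a set $S\subseteq\mathbb{R}$ if every neighbourhood of $x$ contains an element of $S$ different from $x$. *)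

theory Defs
  imports "HOL-Analysis.Analysis"
begin

type_synonym 'a hypergraph = "'a set \<times> 'a set set"

abbreviation verts :: "'a hypergraph \<Rightarrow> 'a set" where
  "verts H \<equiv> fst H"

abbreviation edges :: "'a hypergraph \<Rightarrow> 'a set set" where
  "edges H \<equiv> snd H"

definition kgraph :: "nat \<Rightarrow> 'a hypergraph \<Rightarrow> bool" where
  "kgraph k H \<longleftrightarrow> finite (verts H) \<and> edges H \<subseteq> {e. e \<subseteq> verts H \<and> card e = k}"

definition contains_copy :: "'a hypergraph \<Rightarrow> 'b hypergraph \<Rightarrow> bool" where
  "contains_copy H F \<longleftrightarrow>
     (\<exists>f. inj_on f (verts F) \<and> f ` verts F \<subseteq> verts H \<and> (\<forall>e\<in>edges F. f ` e \<in> edges H))"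

(* The host graphs H have vertices in nat, which loses no generality since they are finite.
   The set of edge numbers is bounded by n choose k, so Sup is its maximum; when no F-free
   k-graph on n vertices exists (F edgeless with at most n vertices) Sup {} = 0 on nat. *)
definition ex_number :: "nat \<Rightarrow> nat \<Rightarrow> 'b hypergraph \<Rightarrow> nat" where
  "ex_number k n F =
     Sup {card (edges H) | H :: nat hypergraph.
            kgraph k H \<and> card (verts H) = n \<and> \<not> contains_copy H F}"

definition turan_density :: "nat \<Rightarrow> 'b hypergraph \<Rightarrow> real" where
  "turan_density k F = lim (\<lambda>n. real (ex_number k n F) / real (n choose k))"

(* Every k-graph is finite, hence isomorphic to one with vertices in nat. *)
definition turan_densities :: "nat \<Rightarrow> real set" where
  "turan_densities k = {turan_density k F | F :: nat hypergraph. kgraph k F}"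

end

theory Submission
  imports Defs
begin

text \<open>Put \<open>r = k - 1\<close> and \<open>q = r! / r\<^sup>r\<close>, the Turan density of the expansion \<open>J\<close> of the complete graph
  on \<open>r + 1\<close> vertices, an \<open>r\<close>-graph; for \<open>k = 3\<close> this is the triangle and \<open>q = 1/2\<close>. Let \<open>T\<^sub>t\<close> be the
  \<open>k\<close>-graph grown from a root in \<open>t\<close> rounds, where every new vertex receives a fresh copy of \<open>J\<close> in
  its link. The densities \<open>\<pi>(T\<^sub>t)\<close> tend to \<open>q\<close> but never reach it.

  Lower bound: split the vertices into \<open>t\<close> levels and \<open>r\<close> colours, and let an edge consist of a lowest
  vertex and one vertex of each colour on higher levels. As \<open>J\<close> is not \<open>r\<close>-partite, each round of
  \<open>T\<^sub>t\<close> uses up one level.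

  Upper bound: if \<open>T\<^sub>t\<close> has no homomorphism to \<open>H\<close>, then \<open>t\<close> rounds of deleting all vertices whose
  current link has no homomorphic image of \<open>J\<close> exhaust \<open>H\<close>. Deleting such vertices one by one
  loses at most a proportion \<open>q\<close> of the available \<open>k\<close>-sets, so by induction the density stays below
  \<open>q\<close>, unless nearly all vertices go in the first round. In that case nearly all links are free of \<open>J\<close>
  at once, which forces a density bounded away from \<open>q\<close>.\<close>

section \<open>Extremal numbers and homomorphisms\<close>

definition hom_to :: "'b hypergraph \<Rightarrow> 'a hypergraph \<Rightarrow> bool" where
  "hom_to F G \<longleftrightarrow> (\<exists>f. f ` verts F \<subseteq> verts G \<and> (\<forall>e\<in>edges F. f ` e \<in> edges G))"

lemma kgraphD:
  assumes "kgraph k H"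
  shows "finite (verts H)" "finite (edges H)" "\<And>e. e \<in> edges H \<Longrightarrow> e \<subseteq> verts H"
    "\<And>e. e \<in> edges H \<Longrightarrow> card e = k" "\<And>e. e \<in> edges H \<Longrightarrow> finite e"
proof -
  show f: "finite (verts H)" and s: "\<And>e. e \<in> edges H \<Longrightarrow> e \<subseteq> verts H"
    and "\<And>e. e \<in> edges H \<Longrightarrow> card e = k"
    using assms by (auto simp: kgraph_def)
  then have "edges H \<subseteq> Pow (verts H)" by auto
  then show "finite (edges H)" using f finite_subset by blast
  show "\<And>e. e \<in> edges H \<Longrightarrow> finite e" using f s finite_subset by blast
qed

lemma card_edges_le:
  assumes "kgraph k H"
  shows "card (edges H) \<le> card (verts H) choose k"
  using assms n_subsets[of "verts H" k] card_mono[of "{e. e \<subseteq> verts H \<and> card e = k}" "edges H"]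
  by (auto simp: kgraph_def)

section \<open>Copies under monotonicity and relabelling\<close>

lemma contains_copy_mono:
  assumes "contains_copy G F" "verts G \<subseteq> verts H" "edges G \<subseteq> edges H"
  shows "contains_copy H F"
  using assms unfolding contains_copy_def by blast

text \<open>Compose the embedding with the inverse of \<open>g\<close>. This lets hosts of any
  vertex type be compared with the hosts on \<open>nat\<close> in \<open>ex_number\<close>.\<close>

lemma contains_copy_host_image:
  assumes "inj_on g (verts H)" "\<And>e. e \<in> edges H \<Longrightarrow> e \<subseteq> verts H"
    and "\<And>e. e \<in> edges F \<Longrightarrow> e \<subseteq> verts F"
    and "contains_copy (g ` verts H, (`) g ` edges H) F"
  shows "contains_copy H F"
proof -
  from assms(4) obtain f where f: "inj_on f (verts F)" "f ` verts F \<subseteq> g ` verts H"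
    "\<And>e. e \<in> edges F \<Longrightarrow> f ` e \<in> (`) g ` edges H"
    unfolding contains_copy_def by auto
  let ?h = "inv_into (verts H) g"
  have "inj_on (?h \<circ> f) (verts F)"
    using f(1,2) by (meson comp_inj_on inj_on_inv_into)
  moreover have "(?h \<circ> f) ` verts F \<subseteq> verts H"
    using f(2) by (auto simp: inv_into_into subset_iff)
  moreover have "(?h \<circ> f) ` e \<in> edges H" if e: "e \<in> edges F" for e
  proof -
    obtain e' where e': "e' \<in> edges H" "f ` e = g ` e'" using f(3)[OF e] by auto
    have "(?h \<circ> f) ` e = ?h ` (g ` e')" by (metis e'(2) image_comp)
    also have "\<dots> = e'" using inv_into_image_cancel[OF assms(1) assms(2)[OF e'(1)]] .
    finally show ?thesis using e' by simp
  qed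
  ultimately show ?thesis unfolding contains_copy_def by blast
qed

lemma contains_copy_forbidden_image:
  assumes "inj g" "\<And>e. e \<in> edges F \<Longrightarrow> e \<subseteq> verts F"
  shows "contains_copy H (g ` verts F, (`) g ` edges F) \<longleftrightarrow> contains_copy H F"
proof
  assume "contains_copy H (g ` verts F, (`) g ` edges F)"
  then obtain f where f: "inj_on f (g ` verts F)" "f ` g ` verts F \<subseteq> verts H"
    "\<And>e. e \<in> edges F \<Longrightarrow> f ` g ` e \<in> edges H"
    unfolding contains_copy_def by auto
  then show "contains_copy H F" unfolding contains_copy_def
    using assms(1)
    by (intro exI[of _ "f \<circ> g"]) (auto simp: image_comp intro: comp_inj_on inj_on_subset)
next
  assume "contains_copy H F"
  then obtain f where f: "inj_on f (verts F)" "f ` verts F \<subseteq> verts H"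
    "\<And>e. e \<in> edges F \<Longrightarrow> f ` e \<in> edges H"
    unfolding contains_copy_def by auto
  have c: "(f \<circ> inv g) ` g ` A = f ` A" for A
    using assms(1) by (simp add: image_comp o_assoc[symmetric])
  have "inj_on (f \<circ> inv g) (g ` verts F)"
    using f(1) assms(1) by (auto simp: inj_on_def)
  then show "contains_copy H (g ` verts F, (`) g ` edges F)" unfolding contains_copy_def
    using f c by (intro exI[of _ "f \<circ> inv g"]) auto
qed

text \<open>Moves the expansion trees, whose vertices are lists, to \<open>nat\<close>, over which
  \<open>turan_densities\<close> ranges.\<close>

lemma turan_density_image:
  assumes "inj g" "\<And>e. e \<in> edges F \<Longrightarrow> e \<subseteq> verts F"
  shows "turan_density k (g ` verts F, (`) g ` edges F) = turan_density k F"
  unfolding turan_density_def ex_number_def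
  by (simp only: contains_copy_forbidden_image[OF assms])

section \<open>Extremal numbers and existence of the limit density\<close>

lemma le_ex_number:
  fixes H :: "'a hypergraph"
  assumes "kgraph k H" "\<not> contains_copy H F" "\<And>e. e \<in> edges F \<Longrightarrow> e \<subseteq> verts F"
  shows "card (edges H) \<le> ex_number k (card (verts H)) F"
proof -
  obtain g :: "'a \<Rightarrow> nat" where g: "inj_on g (verts H)"
    using finite_imp_inj_to_nat_seg kgraphD(1)[OF assms(1)] by metis
  let ?H = "(g ` verts H, (`) g ` edges H)"
  have sub: "edges H \<subseteq> Pow (verts H)" using kgraphD(3)[OF assms(1)] by auto
  have inj: "inj_on ((`) g) (edges H)" using inj_on_image_Pow[OF g] inj_on_subset sub by blast
  have "kgraph k ?H"
    using assms(1) g by (auto simp: kgraph_def card_image inj_on_subset)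
  moreover have "card (verts ?H) = card (verts H)" using g by (simp add: card_image)
  moreover have "\<not> contains_copy ?H F"
    using contains_copy_host_image[OF g _ assms(3)] assms(2) kgraphD(3)[OF assms(1)] by blast
  moreover have "card (edges ?H) = card (edges H)" using inj by (simp add: card_image)
  ultimately have mem: "card (edges H) \<in> {card (edges H') | H' :: nat hypergraph.
      kgraph k H' \<and> card (verts H') = card (verts H) \<and> \<not> contains_copy H' F}" by force
  have "bdd_above {card (edges H') | H' :: nat hypergraph.
      kgraph k H' \<and> card (verts H') = card (verts H) \<and> \<not> contains_copy H' F}"
    using card_edges_le by (intro bdd_aboveI[of _ "card (verts H) choose k"]) force
  from cSup_upper[OF mem this] show ?thesis unfolding ex_number_def .
qed

text \<open>An edge in \<open>F\<close> makes the edgeless hypergraph on \<open>n\<close> vertices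
  free of \<open>F\<close>, so the supremum runs over a nonempty finite set and is a
  maximum.\<close>

lemma ex_number_attained:
  fixes F :: "'b hypergraph"
  assumes "edges F \<noteq> {}"
  obtains H :: "nat hypergraph" where "kgraph k H" "card (verts H) = n" "\<not> contains_copy H F"
    "card (edges H) = ex_number k n F"
proof -
  let ?X = "{card (edges H) | H :: nat hypergraph.
      kgraph k H \<and> card (verts H) = n \<and> \<not> contains_copy H F}"
  have "kgraph k ({..<n}, {})" "card (verts ({..<n}, {})) = n" "\<not> contains_copy ({..<n}, {}) F"
    using assms by (auto simp: kgraph_def contains_copy_def)
  then have ne: "?X \<noteq> {}" by blast
  have "?X \<subseteq> {..n choose k}" using card_edges_le by force
  then have "finite ?X" using finite_subset by blast
  then have "Max ?X \<in> ?X" using ne by (rule Max_in)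
  moreover have "ex_number k n F = Max ?X" unfolding ex_number_def Sup_nat_def using ne by (rule if_not_P)
  ultimately have "ex_number k n F \<in> ?X" by simp
  then obtain H :: "nat hypergraph" where "ex_number k n F = card (edges H)" "kgraph k H"
    "card (verts H) = n" "\<not> contains_copy H F" by blast
  then show thesis using that by simp
qed

text \<open>Double count the pairs of a vertex \<open>v\<close> and an edge avoiding
  \<open>v\<close> in an extremal \<open>H\<close>: each edge is avoided by \<open>Suc n - k\<close>
  vertices, and deleting \<open>v\<close> leaves an \<open>F\<close>-free hypergraph on
  \<open>n\<close> vertices.\<close>

lemma ex_number_Suc:
  assumes ne: "edges F \<noteq> {}" and sub: "\<And>e. e \<in> edges F \<Longrightarrow> e \<subseteq> verts F"
  shows "(Suc n - k) * ex_number k (Suc n) F \<le> Suc n * ex_number k n F"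
proof -
  obtain H :: "nat hypergraph" where H: "kgraph k H" "card (verts H) = Suc n" "\<not> contains_copy H F"
    "card (edges H) = ex_number k (Suc n) F"
    using ex_number_attained[OF ne] .
  have "card {e \<in> edges H. v \<notin> e} \<le> ex_number k n F" if v: "v \<in> verts H" for v
  proof -
    let ?H = "(verts H - {v}, {e \<in> edges H. v \<notin> e})"
    have "kgraph k ?H" using H(1) by (auto simp: kgraph_def)
    moreover have "\<not> contains_copy ?H F" using H(3) contains_copy_mono by fastforce
    moreover have "card (verts ?H) = n" using H(2) v kgraphD[OF H(1)] by simp
    ultimately show ?thesis using le_ex_number[of k ?H F] sub by simp
  qed
  then have "(\<Sum>v\<in>verts H. card {e \<in> edges H. v \<notin> e}) \<le> Suc n * ex_number k n F"
    using sum_bounded_above[of "verts H" "\<lambda>v. card {e \<in> edges H. v \<notin> e}" "ex_number k n F"] H(2)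
    by simp
  moreover have "(\<Sum>v\<in>verts H. card {e \<in> edges H. v \<notin> e}) = (Suc n - k) * card (edges H)"
  proof (rule sum_multicount)
    show "\<forall>e\<in>edges H. card {v \<in> verts H. v \<notin> e} = Suc n - k"
    proof
      fix e assume e: "e \<in> edges H"
      have "{v \<in> verts H. v \<notin> e} = verts H - e" by auto
      then show "card {v \<in> verts H. v \<notin> e} = Suc n - k"
        using kgraphD[OF H(1)] e H(2) by (simp add: card_Diff_subset)
    qed
  qed (use kgraphD[OF H(1)] in auto)
  ultimately show ?thesis using H(4) by simp
qed

lemma ex_ratio_Suc:
  assumes ne: "edges F \<noteq> {}" and sub: "\<And>e. e \<in> edges F \<Longrightarrow> e \<subseteq> verts F" and kn: "k \<le> n"
  shows "real (ex_number k (Suc n) F) / real (Suc n choose k)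
    \<le> real (ex_number k n F) / real (n choose k)"
proof -
  have "(Suc n - k) * (Suc n choose k) = Suc n * (n choose k)"
    using binomial_absorb_comp[of "Suc n" k] by simp
  then have b: "real (Suc n - k) * real (Suc n choose k) = real (Suc n) * real (n choose k)"
    by (metis of_nat_mult)
  have e: "real (Suc n - k) * real (ex_number k (Suc n) F) \<le> real (Suc n) * real (ex_number k n F)"
    using ex_number_Suc[OF ne sub, of n k] by (metis of_nat_le_iff of_nat_mult)
  have pos: "real (Suc n - k) > 0" "real (n choose k) > 0" "real (Suc n choose k) > 0"
    using kn by auto
  have "real (ex_number k (Suc n) F) * (real (Suc n - k) * real (n choose k))
      \<le> real (Suc n) * real (ex_number k n F) * real (n choose k)"
    using mult_right_mono[OF e, of "real (n choose k)"] by (simp add: mult_ac)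
  also have "\<dots> = real (ex_number k n F) * (real (Suc n - k) * real (Suc n choose k))"
    using b by (simp add: mult_ac)
  finally have "real (ex_number k (Suc n) F) * real (n choose k)
      \<le> real (ex_number k n F) * real (Suc n choose k)"
    using pos(1) by (simp add: mult.left_commute[of _ "real (Suc n - k)"])
  then show ?thesis using pos by (simp add: divide_simps mult_ac)
qed

text \<open>By \<open>ex_ratio_Suc\<close> the ratios decrease from \<open>n = k\<close> on, so they
  converge and each of them bounds the limit. The shift by \<open>k\<close> skips the indices where
  the binomial vanishes.\<close>

lemma
  assumes ne: "edges F \<noteq> {}" and sub: "\<And>e. e \<in> edges F \<Longrightarrow> e \<subseteq> verts F"
  shows turan_density_LIMSEQ:
      "(\<lambda>n. real (ex_number k n F) / real (n choose k)) \<longlonglongrightarrow> turan_density k F"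
    and turan_density_le_ratio:
      "k \<le> n \<Longrightarrow> turan_density k F \<le> real (ex_number k n F) / real (n choose k)"
proof -
  let ?f = "\<lambda>n. real (ex_number k n F) / real (n choose k)"
  have dec: "decseq (\<lambda>n. ?f (n + k))"
    using ex_ratio_Suc[OF ne sub] by (intro decseq_SucI) simp
  obtain L where L: "(\<lambda>n. ?f (n + k)) \<longlonglongrightarrow> L" "\<And>n. L \<le> ?f (n + k)"
    using decseq_convergent[OF dec, of 0] by auto
  have lim: "?f \<longlonglongrightarrow> L" using L(1) by (rule LIMSEQ_offset)
  then have "turan_density k F = L" unfolding turan_density_def by (rule limI)
  then show "?f \<longlonglongrightarrow> turan_density k F"
    and "k \<le> n \<Longrightarrow> turan_density k F \<le> ?f n"
    using lim L(2)[of "n - k"] by auto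
qed

section \<open>Supersaturation and the passage from homomorphisms to copies\<close>

lemma card_lists_length_le:
  assumes "finite V" "A \<subseteq> {xs. length xs = N \<and> set xs \<subseteq> V}"
  shows "finite A" "card A \<le> card V ^ N"
proof -
  have eq: "{xs. length xs = N \<and> set xs \<subseteq> V} = {xs. set xs \<subseteq> V \<and> length xs = N}" by auto
  show "finite A" using assms finite_lists_length_eq[OF assms(1), of N] finite_subset eq by metis
  show "card A \<le> card V ^ N"
    using card_mono[OF finite_lists_length_eq[OF assms(1), of N], of A] assms
    by (simp add: eq card_lists_length_eq)
qed

text \<open>The theorem of Erdos on complete multipartite subhypergraphs, for ordered tuples.
  Induction on \<open>N\<close>: averaging yields an \<open>m\<close>-set \<open>S\<close> all of
  whose elements extend the same positive share of tails. Disjointness of the sets comes later, from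
  the tuples in \<open>A\<close> being distinct.\<close>

lemma grid_in_dense_tuples:
  fixes c :: real
  assumes "0 < c" "0 < m"
  shows "\<exists>n0. \<forall>(V :: 'a set) A. finite V \<longrightarrow> n0 \<le> card V \<longrightarrow>
    A \<subseteq> {xs. length xs = N \<and> set xs \<subseteq> V} \<longrightarrow> c * real (card V) ^ N \<le> real (card A) \<longrightarrow>
    (\<exists>Ss. length Ss = N \<and> (\<forall>S\<in>set Ss. S \<subseteq> V \<and> card S = m) \<and>
      (\<forall>xs. list_all2 (\<in>) xs Ss \<longrightarrow> xs \<in> A))"
  using assms(1)
proof (induction N arbitrary: c)
  case 0
  show ?case
  proof (intro exI[of _ 0] allI impI)
    fix V :: "'a set" and A
    assume "A \<subseteq> {xs. length xs = 0 \<and> set xs \<subseteq> V}" "c * real (card V) ^ 0 \<le> real (card A)"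
    then have "A = {[]}" using 0 by (cases "A = {}") auto
    then show "\<exists>Ss. length Ss = 0 \<and> (\<forall>S\<in>set Ss. S \<subseteq> V \<and> card S = m) \<and>
      (\<forall>xs. list_all2 (\<in>) xs Ss \<longrightarrow> xs \<in> A)" by auto
  qed
next
  case (Suc N)
  \<comment> \<open>The factor \<open>c / 2\<close> is the density of tails with many heads. The
    power bounds from below, relative to \<open>n ^ m\<close>, the number of \<open>m\<close>-sets
    inside the head set of such a tail.\<close>
  define c' where "c' = (c / 2) * (c / (2 * real m)) ^ m"
  have "c' > 0" using Suc.prems assms(2) by (simp add: c'_def)
  from Suc.IH[OF this] obtain n1 where n1: "\<And>(V :: 'a set) A. finite V \<Longrightarrow> n1 \<le> card V \<Longrightarrow>
    A \<subseteq> {xs. length xs = N \<and> set xs \<subseteq> V} \<Longrightarrow> c' * real (card V) ^ N \<le> real (card A) \<Longrightarrow>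
    (\<exists>Ss. length Ss = N \<and> (\<forall>S\<in>set Ss. S \<subseteq> V \<and> card S = m) \<and>
      (\<forall>xs. list_all2 (\<in>) xs Ss \<longrightarrow> xs \<in> A))"
    by blast
  obtain n2 :: nat where n2: "2 * real m / c \<le> real n2" using real_arch_simple by blast
  show ?case
  proof (intro exI[of _ "max n1 (max n2 1)"] allI impI)
    fix V :: "'a set" and A
    assume V: "finite V" and big: "max n1 (max n2 1) \<le> card V"
      and A: "A \<subseteq> {xs. length xs = Suc N \<and> set xs \<subseteq> V}"
      and dense: "c * real (card V) ^ Suc N \<le> real (card A)"
    define n where "n = card V"
    define L where "L = {ys. length ys = N \<and> set ys \<subseteq> V}"
    define D where "D ys = {x \<in> V. x # ys \<in> A}" for ys
    define B where "B = {ys \<in> L. c / 2 * real n \<le> real (card (D ys))}"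
    have n: "n \<ge> 1" "n1 \<le> n" using big by (auto simp: n_def)
    \<comment> \<open>This gives \<open>D ys\<close> at least \<open>m\<close> elements for
      \<open>ys\<close> in \<open>B\<close>, as the lower bound on the binomial requires.\<close>
    have mn: "real m \<le> c / 2 * real n"
    proof -
      have "2 * real m / c \<le> real n" using n2 big by (simp add: n_def)
      then show ?thesis using Suc.prems by (simp add: field_simps)
    qed
    have finL: "finite L" and cardL: "card L \<le> n ^ N"
      using card_lists_length_le[OF V, of L N] by (auto simp: L_def n_def)
    have finD: "finite (D ys)" and Dle: "card (D ys) \<le> n" for ys
      using V card_mono[OF V, of "D ys"] by (auto simp: D_def n_def)
    have "A \<subseteq> (\<lambda>(ys, x). x # ys) ` (SIGMA ys:L. D ys)"
    proof
      fix xs assume xs: "xs \<in> A"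
      then obtain x ys where "xs = x # ys" "length ys = N" "x \<in> V" "set ys \<subseteq> V"
        using A by (cases xs) auto
      then show "xs \<in> (\<lambda>(ys, x). x # ys) ` (SIGMA ys:L. D ys)"
        using xs by (intro image_eqI[of _ _ "(ys, x)"]) (auto simp: L_def D_def)
    qed
    then have "card A \<le> card (SIGMA ys:L. D ys)"
      using finL finD by (meson card_image_le card_mono finite_SigmaI finite_imageI order_trans)
    also have "\<dots> = (\<Sum>ys\<in>L. card (D ys))" using finL finD by simp
    finally have "real (card A) \<le> (\<Sum>ys\<in>L. real (card (D ys)))"
      by (metis of_nat_le_iff of_nat_sum)
    \<comment> \<open>Tails outside \<open>B\<close> have fewer than \<open>c / 2 * real n\<close>
      heads, tails in \<open>B\<close> at most \<open>n\<close>.\<close>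
    also have "\<dots> \<le> (\<Sum>ys\<in>L. c / 2 * real n + (if ys \<in> B then real n else 0))"
      using Dle Suc.prems by (intro sum_mono) (auto simp: B_def intro: add_increasing)
    also have "\<dots> = real (card L) * (c / 2 * real n) + real (card B) * real n"
    proof -
      have "L \<inter> B = B" by (auto simp: B_def)
      then show ?thesis by (simp add: sum.distrib sum.If_cases finL)
    qed
    also have "\<dots> \<le> real n ^ N * (c / 2 * real n) + real (card B) * real n"
      using cardL Suc.prems by (intro add_right_mono mult_right_mono) (simp_all flip: of_nat_power)
    finally have "c * real n ^ Suc N \<le> real n ^ N * (c / 2 * real n) + real (card B) * real n"
      using dense by (simp add: n_def)
    then have "real n * (c / 2 * real n ^ N) \<le> real n * real (card B)"
      by (simp add: algebra_simps)
    then have B: "c / 2 * real n ^ N \<le> real (card B)" using n by simp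
    define M where "M = {S. S \<subseteq> V \<and> card S = m}"
    have M: "finite M" "card M = n choose m"
      using V n_subsets[OF V, of m] by (auto simp: M_def n_def)
    define E where "E S = {ys \<in> B. S \<subseteq> D ys}" for S
    have finB: "finite B" using finL by (simp add: B_def)
    have low: "(c / (2 * real m) * real n) ^ m \<le> real (card {S \<in> M. S \<subseteq> D ys})" if "ys \<in> B" for ys
    proof -
      have d: "c / 2 * real n \<le> real (card (D ys))" using that by (simp add: B_def)
      have "{S \<in> M. S \<subseteq> D ys} = {S. S \<subseteq> D ys \<and> card S = m}" by (auto simp: M_def D_def)
      then have eq: "card {S \<in> M. S \<subseteq> D ys} = card (D ys) choose m"
        using n_subsets[OF finD] by simp
      have "(c / (2 * real m) * real n) ^ m \<le> (real (card (D ys)) / real m) ^ m"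
        using d Suc.prems assms(2) by (intro power_mono) (auto simp: field_simps)
      also have "\<dots> \<le> real (card (D ys) choose m)"
        using d mn by (intro binomial_ge_n_over_k_pow_k) linarith
      finally show ?thesis using eq by simp
    qed
    have swap: "(\<Sum>S\<in>M. real (card (E S))) = (\<Sum>ys\<in>B. real (card {S \<in> M. S \<subseteq> D ys}))"
      unfolding E_def of_nat_sum[symmetric] of_nat_eq_iff
      by (rule sum_multicount_gen) (use M finB in auto)
    \<comment> \<open>If every \<open>m\<close>-set were contained in few head sets, counting the
      pairs with \<open>S \<subseteq> D ys\<close> in both orders would contradict
      \<open>low\<close>.\<close>
    have "\<exists>S\<in>M. c' * real n ^ N \<le> real (card (E S))"
    proof (rule ccontr)
      assume "\<not> ?thesis"
      then have less: "real (card (E S)) < c' * real n ^ N" if "S \<in> M" for S using that by force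
      have "c / 2 * real n ^ N * (c / (2 * real m) * real n) ^ m
          \<le> real (card B) * (c / (2 * real m) * real n) ^ m"
        using B Suc.prems by (intro mult_right_mono) auto
      also have "\<dots> \<le> (\<Sum>ys\<in>B. real (card {S \<in> M. S \<subseteq> D ys}))"
        using low sum_mono[of B "\<lambda>_. (c / (2 * real m) * real n) ^ m"] by simp
      also have "\<dots> = (\<Sum>S\<in>M. real (card (E S)))" using swap by simp
      also have "\<dots> < (\<Sum>S\<in>M. c' * real n ^ N)"
      proof (rule sum_strict_mono[OF M(1) _ less])
        have "real m \<le> real n"
        proof -
          have "0 < c / 2 * real n ^ N" using Suc.prems n by simp
          then have "B \<noteq> {}" using B by auto
          then obtain ys where ys: "ys \<in> B" by blast
          then have "c / 2 * real n \<le> real (card (D ys))" by (simp add: B_def)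
          then show ?thesis using mn Dle[of ys] by linarith
        qed
        then have "card M > 0" using M(2) by simp
        then show "M \<noteq> {}" by auto
      qed
      also have "\<dots> \<le> real n ^ m * (c' * real n ^ N)"
      proof -
        have "n choose m \<le> n ^ m"
          using binomial_fact_pow[of n m] fact_ge_1[of m, where 'a = nat]
          by (metis le_trans mult_le_mono2 nat_mult_1_right)
        then have "real (card M) \<le> real n ^ m" using M(2) by (metis of_nat_le_iff of_nat_power)
        then show ?thesis using \<open>c' > 0\<close> by (simp add: mult_right_mono)
      qed
      also have "\<dots> = c / 2 * real n ^ N * (c / (2 * real m) * real n) ^ m"
        unfolding c'_def power_mult_distrib[of "c / (2 * real m)" "real n" m] by (simp only: mult_ac)
      finally show False by simp
    qed
    then obtain S where S: "S \<in> M" "c' * real n ^ N \<le> real (card (E S))" by auto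
    have "E S \<subseteq> {xs. length xs = N \<and> set xs \<subseteq> V}" by (auto simp: E_def B_def L_def)
    from n1[OF V _ this] S(2) n(2) obtain Ss where Ss: "length Ss = N"
      "\<forall>S\<in>set Ss. S \<subseteq> V \<and> card S = m" "\<forall>xs. list_all2 (\<in>) xs Ss \<longrightarrow> xs \<in> E S"
      by (auto simp: n_def)
    have "\<forall>xs. list_all2 (\<in>) xs (S # Ss) \<longrightarrow> xs \<in> A"
      using Ss(3) by (auto simp: list_all2_Cons2 E_def D_def)
    then show "\<exists>Ss. length Ss = Suc N \<and> (\<forall>S\<in>set Ss. S \<subseteq> V \<and> card S = m) \<and>
      (\<forall>xs. list_all2 (\<in>) xs Ss \<longrightarrow> xs \<in> A)"
      using Ss(1,2) S(1) by (intro exI[of _ "S # Ss"]) (auto simp: M_def)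
  qed
qed

lemma binomial_asymp:
  "(\<lambda>n. real (n choose k) * fact k / real n ^ k) \<longlonglongrightarrow> 1"
proof (induction k)
  case 0
  then show ?case by simp
next
  case (Suc k)
  have "(\<lambda>n. 1 - real k / real n) \<longlonglongrightarrow> 1 - 0"
    by (intro tendsto_diff tendsto_const lim_const_over_n)
  from tendsto_mult[OF Suc this]
  have lim: "(\<lambda>n. real (n choose k) * fact k / real n ^ k * (1 - real k / real n)) \<longlonglongrightarrow> 1" by simp
  show ?case
  proof (rule Lim_transform_eventually[OF lim])
    show "\<forall>\<^sub>F n in sequentially. real (n choose k) * fact k / real n ^ k * (1 - real k / real n)
        = real (n choose Suc k) * fact (Suc k) / real n ^ Suc k"
      using eventually_gt_at_top[of k]
    proof eventually_elim
      case (elim n)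
      have "Suc k * (n choose Suc k) = (n - k) * (n choose k)"
        using binomial_absorb_comp[of n k] binomial_absorption[of k n] by simp
      then have "real (Suc k) * real (n choose Suc k) = (real n - real k) * real (n choose k)"
        using elim by (metis of_nat_mult of_nat_diff less_imp_le)
      moreover have "real (n choose Suc k) * fact (Suc k) =
          fact k * (real (Suc k) * real (n choose Suc k))"
        by (simp add: fact_Suc mult_ac)
      ultimately show ?case using elim by (simp add: divide_simps mult_ac)
    qed
  qed
qed

text \<open>Double counting: the \<open>N\<close>-sets containing a given edge correspond to the
  subsets of size \<open>N - k\<close> of the remaining vertices.\<close>

lemma sum_induced_edges:
  assumes H: "kgraph k H" and kN: "k \<le> N"
  shows "(\<Sum>W | W \<subseteq> verts H \<and> card W = N. card {e \<in> edges H. e \<subseteq> W})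
    = (card (verts H) - k choose (N - k)) * card (edges H)"
proof (rule sum_multicount)
  note fin = kgraphD[OF H]
  show "finite {W. W \<subseteq> verts H \<and> card W = N}" using fin(1) by auto
  show "finite (edges H)" by (rule fin)
  show "\<forall>e\<in>edges H. card {W \<in> {W. W \<subseteq> verts H \<and> card W = N}. e \<subseteq> W}
      = (card (verts H) - k choose (N - k))"
  proof
    fix e assume e: "e \<in> edges H"
    have "bij_betw (\<lambda>S. S \<union> e) {S. S \<subseteq> verts H - e \<and> card S = N - k}
      {W \<in> {W. W \<subseteq> verts H \<and> card W = N}. e \<subseteq> W}"
    proof (rule bij_betw_byWitness[of _ "\<lambda>W. W - e"])
      show "(\<lambda>S. S \<union> e) ` {S. S \<subseteq> verts H - e \<and> card S = N - k}
        \<subseteq> {W \<in> {W. W \<subseteq> verts H \<and> card W = N}. e \<subseteq> W}"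
      proof (rule image_subsetI)
        fix S assume S: "S \<in> {S. S \<subseteq> verts H - e \<and> card S = N - k}"
        then have "finite S" using fin(1) finite_subset by blast
        then have "card (S \<union> e) = N"
          using S e fin(4,5)[OF e] kN card_Un_disjoint[of S e] by auto
        then show "S \<union> e \<in> {W \<in> {W. W \<subseteq> verts H \<and> card W = N}. e \<subseteq> W}"
          using S fin(3)[OF e] by auto
      qed
      show "(\<lambda>W. W - e) ` {W \<in> {W. W \<subseteq> verts H \<and> card W = N}. e \<subseteq> W}
        \<subseteq> {S. S \<subseteq> verts H - e \<and> card S = N - k}"
        using fin(4,5)[OF e] by (auto simp: card_Diff_subset)
    qed auto
    then have "card {W \<in> {W. W \<subseteq> verts H \<and> card W = N}. e \<subseteq> W}
        = card {S. S \<subseteq> verts H - e \<and> card S = N - k}"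
      by (rule bij_betw_same_card[symmetric])
    also have "\<dots> = (card (verts H) - k choose (N - k))"
      using n_subsets[of "verts H - e" "N - k"] fin(1) fin(3,4,5)[OF e]
      by (simp add: card_Diff_subset)
    finally show "card {W \<in> {W. W \<subseteq> verts H \<and> card W = N}. e \<subseteq> W}
        = (card (verts H) - k choose (N - k))" .
  qed
qed

text \<open>The mean density of the induced hypergraphs over all \<open>N\<close>-sets is the
  density of \<open>H\<close>, hence at least \<open>p\<close>. Sets of density at most
  \<open>\<mu>\<close> contribute at most \<open>\<mu>\<close> to this mean, and each other set
  counts at most 1.\<close>

lemma many_dense_subsets:
  fixes \<mu> p :: real
  assumes H: "kgraph k H" and kN: "k \<le> N" and Nn: "N \<le> card (verts H)" and "0 \<le> \<mu>"
    and dense: "p * real (card (verts H) choose k) \<le> real (card (edges H))"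
  shows "(p - \<mu>) * real (card (verts H) choose N) \<le> real (card {W. W \<subseteq> verts H \<and> card W = N \<and>
    \<mu> * real (N choose k) < real (card {e \<in> edges H. e \<subseteq> W})})"
proof -
  note fin = kgraphD[OF H]
  define n where "n = card (verts H)"
  define A where "A = {W. W \<subseteq> verts H \<and> card W = N}"
  define d where "d W = card {e \<in> edges H. e \<subseteq> W}" for W
  define G where "G = {W \<in> A. \<mu> * real (N choose k) < real (d W)}"
  have A: "finite A" "card A = n choose N"
    using fin(1) n_subsets[OF fin(1), of N] by (auto simp: A_def n_def)
  have dle: "real (d W) \<le> real (N choose k)" if "W \<in> A" for W
  proof -
    have "kgraph k (W, {e \<in> edges H. e \<subseteq> W})"
      using that H finite_subset[OF _ fin(1)] by (auto simp: A_def kgraph_def)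
    from card_edges_le[OF this] that show ?thesis by (simp add: d_def A_def)
  qed
  have "p * real (n choose k) * real ((n - k) choose (N - k))
      \<le> real (card (edges H)) * real ((n - k) choose (N - k))"
    using dense by (intro mult_right_mono) (auto simp: n_def)
  also have "\<dots> = (\<Sum>W\<in>A. real (d W))"
    using sum_induced_edges[OF H kN] by (simp add: A_def d_def n_def flip: of_nat_sum of_nat_mult)
  also have "\<dots> \<le> (\<Sum>W\<in>A. \<mu> * real (N choose k) + (if W \<in> G then real (N choose k) else 0))"
    using dle assms(4) by (intro sum_mono) (auto simp: G_def intro: add_increasing)
  also have "\<dots> = \<mu> * real (N choose k) * real (n choose N) + real (card G) * real (N choose k)"
  proof -
    have "A \<inter> G = G" by (auto simp: G_def)
    then show ?thesis using A by (simp add: sum.distrib sum.If_cases)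
  qed
  finally have "p * (real (n choose k) * real ((n - k) choose (N - k)))
      \<le> \<mu> * real (N choose k) * real (n choose N) + real (card G) * real (N choose k)" by simp
  moreover have "real (n choose k) * real ((n - k) choose (N - k)) = real (n choose N) * real (N choose k)"
    using choose_mult[of k N n] kN Nn by (simp add: n_def flip: of_nat_mult)
  ultimately have "((p - \<mu>) * real (n choose N)) * real (N choose k) \<le> real (card G) * real (N choose k)"
    by (simp add: algebra_simps)
  moreover have "real (N choose k) > 0" using kN by simp
  ultimately have "(p - \<mu>) * real (n choose N) \<le> real (card G)" by simp
  moreover have "G = {W. W \<subseteq> verts H \<and> card W = N \<and>
    \<mu> * real (N choose k) < real (card {e \<in> edges H. e \<subseteq> W})}" by (auto simp: G_def A_def d_def)
  ultimately show ?thesis by (simp add: n_def)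
qed

text \<open>A grid of tuples realising one pattern \<open>g\<close> turns a homomorphism into an
  injective copy: \<open>u\<close> is sent into the part with index \<open>g u\<close>, to the
  element with its own number \<open>\<iota> u\<close>, so vertices sharing a part are
  separated.\<close>

lemma contains_copy_of_grid:
  assumes F: "kgraph k F" and ne: "edges F \<noteq> {}" and k: "k \<ge> 1" and H: "kgraph k H"
    and g: "g ` verts F \<subseteq> {..<N}"
    and Ss: "length Ss = N" "\<And>S. S \<in> set Ss \<Longrightarrow> S \<subseteq> verts H \<and> card S = card (verts F)"
    and grid: "\<And>xs. list_all2 (\<in>) xs Ss \<Longrightarrow>
      distinct xs \<and> (\<forall>e\<in>edges F. (\<lambda>u. xs ! g u) ` e \<in> edges H)"
  shows "contains_copy H F"
proof -
  define m where "m = card (verts F)"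
  have m: "m > 0"
  proof -
    obtain e where e: "e \<in> edges F" using ne by auto
    then have "verts F \<noteq> {}" using kgraphD(3,4)[OF F e] k by fastforce
    then show ?thesis using kgraphD(1)[OF F] by (simp add: m_def card_gt_0_iff)
  qed
  obtain \<iota> where \<iota>: "bij_betw \<iota> (verts F) {..<m}"
    using ex_bij_betw_finite_nat[OF kgraphD(1)[OF F]] by (auto simp: m_def atLeast0LessThan)
  have "\<exists>h. bij_betw h {..<m} (Ss ! i)" if "i < N" for i
  proof -
    have S: "Ss ! i \<in> set Ss" using that Ss(1) by simp
    then have "finite (Ss ! i)" "card (Ss ! i) = m"
      using Ss(2) finite_subset[OF _ kgraphD(1)[OF H]] by (auto simp: m_def)
    then show ?thesis using ex_bij_betw_nat_finite by (metis atLeast0LessThan)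
  qed
  then obtain h where h: "\<And>i. i < N \<Longrightarrow> bij_betw (h i) {..<m} (Ss ! i)" by metis
  define \<psi> where "\<psi> u = h (g u) (\<iota> u)" for u
  have gN: "g u < N" if "u \<in> verts F" for u using g that by auto
  have \<iota>m: "\<iota> u < m" if "u \<in> verts F" for u using \<iota> that by (auto simp: bij_betw_def)
  define pick where "pick j = map (\<lambda>i. h i (j i)) [0..<N]" for j
  have pick: "list_all2 (\<in>) (pick j) Ss" if "\<And>i. i < N \<Longrightarrow> j i < m" for j
    unfolding list_all2_conv_all_nth
    using that h Ss(1) by (auto simp: pick_def bij_betw_def)
  have len: "length (pick j) = N" for j by (simp add: pick_def)
  have pick_nth: "pick j ! i = h i (j i)" if "i < N" for i j using that by (simp add: pick_def)
  have "inj_on \<psi> (verts F)"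
  proof (rule inj_onI)
    fix u u' assume u: "u \<in> verts F" and u': "u' \<in> verts F" and eq: "\<psi> u = \<psi> u'"
    show "u = u'"
    proof (cases "g u = g u'")
      case True
      then have "\<iota> u = \<iota> u'"
        using eq h[OF gN[OF u]] \<iota>m[OF u] \<iota>m[OF u'] by (auto simp: \<psi>_def bij_betw_def inj_on_def)
      then show ?thesis using \<iota> u u' by (auto simp: bij_betw_def inj_on_def)
    next
      case False
      \<comment> \<open>A tuple that contains both images at once; tuples of the grid have distinct
        entries.\<close>
      define j where "j i = (if i = g u then \<iota> u else \<iota> u')" for i
      have "distinct (pick j)" using grid[OF pick] \<iota>m u u' by (simp add: j_def)
      moreover have "pick j ! g u = pick j ! g u'"
        using eq False gN u u' by (simp add: pick_nth j_def \<psi>_def)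
      ultimately show ?thesis
        using nth_eq_iff_index_eq[of "pick j" "g u" "g u'"] False gN[OF u] gN[OF u']
        by (simp add: len)
    qed
  qed
  moreover have "\<psi> ` verts F \<subseteq> verts H"
  proof (rule image_subsetI)
    fix u assume u: "u \<in> verts F"
    then have "\<psi> u \<in> Ss ! g u" using h[OF gN[OF u]] \<iota>m[OF u] by (auto simp: \<psi>_def bij_betw_def)
    then show "\<psi> u \<in> verts H" using Ss gN[OF u] nth_mem by blast
  qed
  moreover have "\<psi> ` e \<in> edges H" if e: "e \<in> edges F" for e
  proof -
    have ev: "e \<subseteq> verts F" by (rule kgraphD(3)[OF F e])
    \<comment> \<open>The image of \<open>e\<close> is an edge of \<open>H\<close> and so has
      \<open>k\<close> elements. Hence \<open>g\<close> is injective on \<open>e\<close>, and one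
      tuple can hold at position \<open>g u\<close> the element meant for \<open>u\<close>, for all
      \<open>u\<close> in \<open>e\<close>.\<close>
    have "(\<lambda>u. pick (\<lambda>_. 0) ! g u) ` e \<in> edges H" using grid[OF pick[OF m]] e by blast
    then have "card ((\<lambda>u. pick (\<lambda>_. 0) ! g u) ` e) = card e"
      using kgraphD(4)[OF H] kgraphD(4)[OF F e] by simp
    then have "inj_on (\<lambda>u. pick (\<lambda>_. 0) ! g u) e"
      using kgraphD(5)[OF F e] by (rule eq_card_imp_inj_on[rotated])
    then have ginj: "inj_on g e" by (auto simp: inj_on_def)
    define j where "j i = (if i \<in> g ` e then \<iota> (inv_into e g i) else 0)" for i
    have jm: "j i < m" for i
      using m \<iota>m ev inv_into_into[of i g e] by (auto simp: j_def)
    have "(\<lambda>u. pick j ! g u) ` e \<in> edges H" using grid[OF pick[of j, OF jm]] e by blast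
    moreover have "(\<lambda>u. pick j ! g u) ` e = \<psi> ` e"
    proof (rule image_cong[OF refl])
      fix u assume "u \<in> e"
      then show "pick j ! g u = \<psi> u"
        using ginj gN ev by (auto simp: pick_nth j_def \<psi>_def)
    qed
    ultimately show ?thesis by simp
  qed
  ultimately show ?thesis unfolding contains_copy_def by blast
qed

text \<open>If the density \<open>p\<close> exceeded \<open>b\<close>, a positive share of the
  \<open>N\<close>-sets of a large extremal \<open>H\<close> would be so dense that \<open>F\<close>
  maps to them. By pigeonhole many of these maps share one pattern of positions, and a grid of
  tuples with that pattern contains a copy of \<open>F\<close>.\<close>

lemma turan_density_le_of_hom_free_bound:
  fixes F :: "'b hypergraph" and b :: real
  assumes F: "kgraph k F" and ne: "edges F \<noteq> {}" and k: "k \<ge> 1" and "0 \<le> b"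
    and bound: "\<And>G :: nat hypergraph. kgraph k G \<Longrightarrow> \<not> hom_to F G \<Longrightarrow>
      real (card (edges G)) * fact k \<le> b * real (card (verts G)) ^ k"
  shows "turan_density k F \<le> b"
proof (rule ccontr)
  define p where "p = turan_density k F"
  assume "\<not> ?thesis"
  then have "b < p" by (simp add: p_def)
  then obtain \<mu> where \<mu>: "b < \<mu>" "\<mu> < p" using dense by blast
  have "b / \<mu> < 1" using \<mu> assms(4) by simp
  \<comment> \<open>\<open>N\<close> is taken so large that \<open>b * real N ^ k\<close> stays
    below \<open>\<mu> * real (N choose k) * fact k\<close>; a hypergraph on \<open>N\<close>
    vertices of density above \<open>\<mu>\<close> then violates the conclusion of
    \<open>bound\<close>.\<close>
  from order_tendstoD(1)[OF binomial_asymp[of k] this]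
  have "eventually (\<lambda>N. b / \<mu> < real (N choose k) * fact k / real N ^ k) sequentially" .
  then have "eventually (\<lambda>N. k \<le> N \<and> b / \<mu> < real (N choose k) * fact k / real N ^ k) sequentially"
    using eventually_ge_at_top[of k] by eventually_elim auto
  then obtain N where N: "k \<le> N" "b / \<mu> < real (N choose k) * fact k / real N ^ k"
    using eventually_happens by (metis (no_types, lifting) eventually_sequentially order_refl)
  have N1: "N \<ge> 1" using N k by simp
  have lamN: "b * real N ^ k < \<mu> * real (N choose k) * fact k"
    using N(2) N1 \<mu> assms(4) by (simp add: field_simps)
  define m where "m = card (verts F)"
  have m: "m > 0"
  proof -
    obtain e where e: "e \<in> edges F" using ne by auto
    then have "verts F \<noteq> {}" using kgraphD(3,4)[OF F e] k by fastforce
    then show ?thesis using kgraphD(1)[OF F] by (simp add: m_def card_gt_0_iff)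
  qed
  \<comment> \<open>\<open>N ^ N\<close> stems from the lower bound \<open>(n / N) ^ N\<close> for
    the binomial, and \<open>N ^ m\<close> is the number of patterns.\<close>
  define c where "c = (p - \<mu>) / (real N ^ N * real N ^ m)"
  have "c > 0" using \<mu> N1 by (simp add: c_def)
  from grid_in_dense_tuples[OF this m, of N] obtain n0 where n0:
    "\<And>(V :: nat set) A. finite V \<Longrightarrow> n0 \<le> card V \<Longrightarrow>
    A \<subseteq> {xs. length xs = N \<and> set xs \<subseteq> V} \<Longrightarrow> c * real (card V) ^ N \<le> real (card A) \<Longrightarrow>
    (\<exists>Ss. length Ss = N \<and> (\<forall>S\<in>set Ss. S \<subseteq> V \<and> card S = m) \<and>
      (\<forall>xs. list_all2 (\<in>) xs Ss \<longrightarrow> xs \<in> A))" by blast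
  define n where "n = max n0 N"
  have sub: "\<And>e. e \<in> edges F \<Longrightarrow> e \<subseteq> verts F" by (rule kgraphD(3)[OF F])
  obtain H :: "nat hypergraph" where H: "kgraph k H" "card (verts H) = n" "\<not> contains_copy H F"
    "card (edges H) = ex_number k n F"
    using ex_number_attained[OF ne] .
  note fin = kgraphD[OF H(1)]
  have "k \<le> n" using N by (simp add: n_def)
  then have "p * real (n choose k) \<le> real (card (edges H))"
    using turan_density_le_ratio[OF ne sub, of k n] by (simp add: p_def H(4) field_simps)
  then have many: "(p - \<mu>) * real (n choose N) \<le> real (card {W. W \<subseteq> verts H \<and> card W = N \<and>
    \<mu> * real (N choose k) < real (card {e \<in> edges H. e \<subseteq> W})})"
    using many_dense_subsets[OF H(1) N(1), of \<mu> p] H(2) \<mu> assms(4) by (simp add: n_def)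
  define G where "G = {W. W \<subseteq> verts H \<and> card W = N \<and>
    \<mu> * real (N choose k) < real (card {e \<in> edges H. e \<subseteq> W})}"
  define A where "A g = {xs. length xs = N \<and> set xs \<subseteq> verts H \<and> distinct xs \<and>
    (\<forall>e\<in>edges F. (\<lambda>u. xs ! g u) ` e \<in> edges H)}" for g :: "'b \<Rightarrow> nat"
  define P where "P = (verts F \<rightarrow>\<^sub>E {..<N})"
  have P: "finite P" "card P = N ^ m"
    using kgraphD(1)[OF F] by (auto simp: P_def m_def card_PiE intro: finite_PiE)
  have finA: "finite (A g)" for g
    using card_lists_length_le(1)[OF fin(1), of "A g" N] by (auto simp: A_def)
  have "G \<subseteq> set ` (\<Union>g\<in>P. A g)"
  proof
    fix W assume "W \<in> G"
    then have W: "W \<subseteq> verts H" "card W = N" "\<mu> * real (N choose k) < real (card {e \<in> edges H. e \<subseteq> W})"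
      by (auto simp: G_def)
    have finW: "finite W" using W(1) fin(1) finite_subset by blast
    let ?G = "(W, {e \<in> edges H. e \<subseteq> W})"
    have kG: "kgraph k ?G" using H(1) finW by (auto simp: kgraph_def)
    have "hom_to F ?G"
    proof (rule ccontr)
      assume "\<not> hom_to F ?G"
      from bound[OF kG this] have "real (card {e \<in> edges H. e \<subseteq> W}) * fact k \<le> b * real N ^ k"
        using W(2) by simp
      moreover have "\<mu> * real (N choose k) * fact k \<le> real (card {e \<in> edges H. e \<subseteq> W}) * fact k"
        using W(3) by (intro mult_right_mono) auto
      ultimately show False using lamN by linarith
    qed
    then obtain f where f: "f ` verts F \<subseteq> W" "\<And>e. e \<in> edges F \<Longrightarrow> f ` e \<in> edges H"
      unfolding hom_to_def by auto
    obtain xs where xs: "set xs = W" "distinct xs" using finite_distinct_list[OF finW] by blast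
    then have len: "length xs = N" using W(2) distinct_card by metis
    \<comment> \<open>The pattern of \<open>f\<close>: the position of each \<open>f u\<close> in
      the enumeration \<open>xs\<close> of \<open>W\<close>. Restriction to \<open>verts F\<close>
      puts it into the finite set \<open>P\<close>.\<close>
    define g where "g = (\<lambda>u\<in>verts F. SOME i. i < N \<and> xs ! i = f u)"
    have g: "g u < N \<and> xs ! g u = f u" if "u \<in> verts F" for u
    proof -
      have "f u \<in> set xs" using f(1) that xs by auto
      then have "\<exists>i. i < N \<and> xs ! i = f u" using len by (auto simp: in_set_conv_nth)
      from someI_ex[OF this] show ?thesis using that by (simp add: g_def)
    qed
    have "g \<in> P" unfolding P_def using g by (auto simp: g_def)
    moreover have "xs \<in> A g"
    proof -
      have "(\<lambda>u. xs ! g u) ` e \<in> edges H" if e: "e \<in> edges F" for e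
      proof -
        have "(\<lambda>u. xs ! g u) ` e = f ` e" using g sub[OF e] by (intro image_cong) auto
        then show ?thesis using f(2)[OF e] by simp
      qed
      then show ?thesis using xs len W(1) by (simp add: A_def)
    qed
    ultimately show "W \<in> set ` (\<Union>g\<in>P. A g)" using xs(1) by blast
  qed
  then have "card G \<le> card (set ` (\<Union>g\<in>P. A g))"
    using P(1) finA by (intro card_mono finite_imageI finite_UN_I)
  also have "\<dots> \<le> card (\<Union>g\<in>P. A g)"
    using P(1) finA by (intro card_image_le finite_UN_I)
  also have "\<dots> \<le> (\<Sum>g\<in>P. card (A g))" using P(1) by (rule card_UN_le)
  finally have GA: "real (card G) \<le> (\<Sum>g\<in>P. real (card (A g)))"
    by (metis of_nat_le_iff of_nat_sum)
  have "\<exists>g\<in>P. c * real n ^ N \<le> real (card (A g))"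
  proof (rule ccontr)
    assume "\<not> ?thesis"
    then have less: "real (card (A g)) < c * real n ^ N" if "g \<in> P" for g using that by force
    have "P \<noteq> {}" using P(2) N1 by auto
    have "(\<Sum>g\<in>P. real (card (A g))) < (\<Sum>g\<in>P. c * real n ^ N)"
      by (rule sum_strict_mono[OF P(1) \<open>P \<noteq> {}\<close> less])
    also have "\<dots> = (p - \<mu>) * (real n / real N) ^ N"
      using N1 by (simp add: P(2) c_def power_divide)
    also have "\<dots> \<le> (p - \<mu>) * real (n choose N)"
      using \<mu> by (intro mult_left_mono binomial_ge_n_over_k_pow_k) (auto simp: n_def)
    also have "\<dots> \<le> real (card G)" using many by (simp add: G_def)
    finally show False using GA by simp
  qed
  then obtain g where g: "g \<in> P" "c * real n ^ N \<le> real (card (A g))" by blast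
  have "\<exists>Ss. length Ss = N \<and> (\<forall>S\<in>set Ss. S \<subseteq> verts H \<and> card S = m) \<and>
      (\<forall>xs. list_all2 (\<in>) xs Ss \<longrightarrow> xs \<in> A g)"
    using g(2) H(2) by (intro n0[OF fin(1)]) (auto simp: A_def n_def)
  then obtain Ss where Ss: "length Ss = N" "\<forall>S\<in>set Ss. S \<subseteq> verts H \<and> card S = m"
    "\<And>xs. list_all2 (\<in>) xs Ss \<Longrightarrow> xs \<in> A g" by blast
  have "contains_copy H F"
    by (rule contains_copy_of_grid[OF F ne k H(1), of g N Ss])
      (use g(1) Ss in \<open>auto simp: P_def A_def m_def\<close>)
  then show False using H(3) by simp
qed

section \<open>Hypergraphs with clique-free links\<close>

text \<open>AM-GM for \<open>a\<close> and \<open>s\<close> copies of \<open>b / s\<close>, cleared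
  of denominators.\<close>

lemma weighted_am_gm:
  fixes a b :: real
  assumes "0 \<le> a" "0 \<le> b"
  shows "a * b ^ s * real (Suc s) ^ Suc s \<le> real s ^ s * (a + b) ^ Suc s"
proof (cases "s = 0")
  case True
  then show ?thesis using assms by simp
next
  case False
  show ?thesis
  proof (cases "b = 0")
    case True
    then have "a * b ^ s * real (Suc s) ^ Suc s = 0" using False by simp
    moreover have "0 \<le> real s ^ s * (a + b) ^ Suc s"
      using assms by (intro mult_nonneg_nonneg zero_le_power) auto
    ultimately show ?thesis by linarith
  next
    case b: False
    text \<open>Bernoulli applied to the ratio of the mean to \<open>b / s\<close>.\<close>
    define m where "m = (a + b) / real (Suc s)"
    define y where "y = b / real s"
    have y: "y > 0" using False b assms by (simp add: y_def)
    have m: "m \<ge> 0" using assms by (simp add: m_def)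
    have "1 + real (Suc s) * (m / y - 1) \<le> (1 + (m / y - 1)) ^ Suc s"
      using m y by (intro Bernoulli_inequality) simp
    moreover have "1 + real (Suc s) * (m / y - 1) = a / y"
    proof -
      have "real (Suc s) * m = a + real s * y" using False by (simp add: m_def y_def)
      then have "real (Suc s) * (m / y) = a / y + real s" using y by (simp add: field_simps)
      then show ?thesis by (simp add: algebra_simps)
    qed
    ultimately have "a / y \<le> (m / y) ^ Suc s" by simp
    then have "a * y ^ s \<le> m ^ Suc s" using y by (simp add: power_divide field_simps)
    then have "a * (b ^ s / real s ^ s) \<le> (a + b) ^ Suc s / real (Suc s) ^ Suc s"
      by (simp add: m_def y_def power_divide)
    then show ?thesis using False by (simp add: divide_simps mult_ac split: if_splits)
  qed
qed

section \<open>Pairwise covered vertices and links\<close>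

definition covered :: "'a set set \<Rightarrow> 'a \<Rightarrow> 'a \<Rightarrow> bool" where
  "covered G x y \<longleftrightarrow> x \<noteq> y \<and> (\<exists>f\<in>G. x \<in> f \<and> y \<in> f)"

text \<open>For uniform \<open>G\<close> this encodes a homomorphic image of the expansion of the
  complete graph on \<open>s\<close> vertices: the private vertices fill up a covering edge, so only
  the core is recorded.\<close>

definition covers_clique :: "nat \<Rightarrow> 'a set set \<Rightarrow> bool" where
  "covers_clique s G \<longleftrightarrow> (\<exists>X. finite X \<and> card X = s \<and> (\<forall>x\<in>X. \<forall>y\<in>X. x \<noteq> y \<longrightarrow> covered G x y))"

definition link :: "'a set set \<Rightarrow> 'a \<Rightarrow> 'a set set" where
  "link E v = (\<lambda>e. e - {v}) ` {e \<in> E. v \<in> e}"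

lemma card_link: "card (link E v) = card {e \<in> E. v \<in> e}"
  unfolding link_def by (intro card_image) (auto simp: inj_on_def)

lemma mem_link: "f \<in> link E v \<longleftrightarrow> v \<notin> f \<and> insert v f \<in> E"
proof
  assume "v \<notin> f \<and> insert v f \<in> E"
  then show "f \<in> link E v" unfolding link_def by (intro image_eqI[of _ _ "insert v f"]) auto
next
  assume "f \<in> link E v"
  then obtain e where e: "e \<in> E" "v \<in> e" "f = e - {v}" by (auto simp: link_def)
  have "insert v f = e" unfolding e(3) by (rule insert_Diff[OF e(2)])
  moreover have "v \<notin> f" unfolding e(3) by simp
  ultimately show "v \<notin> f \<and> insert v f \<in> E" using e(1) by (simp only: simp_thms)
qed

lemma covered_sym: "covered G x y \<longleftrightarrow> covered G y x"
  by (auto simp: covered_def)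

lemma covered_link_iff:
  "covered (link E v) x y \<longleftrightarrow> x \<noteq> y \<and> x \<noteq> v \<and> y \<noteq> v \<and> (\<exists>e\<in>E. v \<in> e \<and> x \<in> e \<and> y \<in> e)"
  by (auto simp: covered_def link_def)

lemma covered_linkD:
  assumes "covered (link E v) x y"
  shows "covered E x y" "covered E v x"
proof -
  from assms obtain e where "e \<in> E" "v \<in> e" "x \<in> e" "y \<in> e" "x \<noteq> y" "x \<noteq> v"
    unfolding covered_link_iff by blast
  then show "covered E x y" "covered E v x" unfolding covered_def by blast+
qed

text \<open>Add \<open>u\<close> to a clique of its own link: a covering edge, extended by
  \<open>u\<close>, covers its vertices also with \<open>u\<close>. As \<open>r \<ge> 2\<close>,
  every vertex of the clique lies in such an edge.\<close>

lemma covers_clique_link: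
  assumes "covers_clique r (link G u)" "r \<ge> 2"
  shows "covers_clique (Suc r) G"
proof -
  from assms(1) obtain X where X: "finite X" "card X = r"
    "\<And>x y. x \<in> X \<Longrightarrow> y \<in> X \<Longrightarrow> x \<noteq> y \<Longrightarrow> covered (link G u) x y"
    unfolding covers_clique_def by auto
  have other: "\<exists>y\<in>X. y \<noteq> x" for x
  proof (rule ccontr)
    assume "\<not> ?thesis"
    then have "X \<subseteq> {x}" by auto
    then show False using X(2) assms(2) card_mono[of "{x}" X] by simp
  qed
  have u: "u \<notin> X" using X(3) other by (metis covered_link_iff)
  have "covered G u x" if x: "x \<in> X" for x
  proof -
    obtain y where "y \<in> X" "x \<noteq> y" using other[of x] by auto
    then show ?thesis using covered_linkD(2)[OF X(3)[OF x]] by blast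
  qed
  moreover from this have "covered G x u" if "x \<in> X" for x
    using that covered_sym[of G x u] by blast
  moreover have "covered G x y" if "x \<in> X" "y \<in> X" "x \<noteq> y" for x y
    using covered_linkD(1)[OF X(3)[OF that]] .
  ultimately have "\<forall>x\<in>insert u X. \<forall>y\<in>insert u X. x \<noteq> y \<longrightarrow> covered G x y" by blast
  then show ?thesis using X u unfolding covers_clique_def by (intro exI[of _ "insert u X"]) auto
qed

definition nonadj :: "'a set set \<Rightarrow> 'a \<Rightarrow> 'a set \<Rightarrow> nat" where
  "nonadj G w f = card {u \<in> f. \<not> covered G u w}"

text \<open>Otherwise \<open>w\<close> is covered with every vertex of \<open>f\<close>, hence lies
  outside \<open>f\<close>, and \<open>insert w f\<close> is a forbidden clique.\<close>

lemma nonadj_ge_1: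
  assumes "\<not> covers_clique (Suc r) G" "f \<in> G" "finite f" "card f = r"
  shows "1 \<le> nonadj G w f"
proof (rule ccontr)
  assume "\<not> ?thesis"
  then have "card {u \<in> f. \<not> covered G u w} = 0" by (simp add: nonadj_def)
  then have "{u \<in> f. \<not> covered G u w} = {}" using assms(3) by simp
  then have all: "covered G u w" if "u \<in> f" for u
    using that by blast
  then have "w \<notin> f" by (auto simp: covered_def)
  moreover have "covered G x y" if "x \<in> f" "y \<in> f" "x \<noteq> y" for x y
    using that assms(2) by (auto simp: covered_def)
  moreover have "covered G w u" if "u \<in> f" for u
    using all[OF that] covered_sym[of G w u] by blast
  ultimately have "\<forall>x\<in>insert w f. \<forall>y\<in>insert w f. x \<noteq> y \<longrightarrow> covered G x y"
    using all by blast
  then have "covers_clique (Suc r) G"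
    unfolding covers_clique_def using assms \<open>w \<notin> f\<close> by (intro exI[of _ "insert w f"]) auto
  then show False using assms(1) by simp
qed

text \<open>Induction on \<open>r\<close>. The link of \<open>u\<close> lives on the neighbours
  \<open>N u\<close> and has no clique of size \<open>r\<close>, so the degree of \<open>u\<close>
  is at most \<open>(card (N u) / (r - 1)) ^ (r - 1)\<close>; times the number of non-neighbours
  this is at most \<open>(n / r) ^ r\<close> by AM-GM. Summing over \<open>u\<close> gives the first
  bound, and the second follows since every \<open>nonadj\<close> is at least 1. Balanced complete
  \<open>r\<close>-partite hypergraphs attain both.\<close>

lemma
  assumes "finite U" "r \<ge> 1" "\<And>f. f \<in> G \<Longrightarrow> f \<subseteq> U \<and> card f = r" "\<not> covers_clique (Suc r) G"
  shows sum_nonadj_le: "r \<ge> 2 \<Longrightarrow> (\<Sum>f\<in>G. \<Sum>w\<in>U. nonadj G w f) * r ^ r \<le> card U ^ Suc r"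
    and card_clique_free_le: "card G * r ^ r \<le> card U ^ r"
proof -
  have "(r \<ge> 2 \<longrightarrow> (\<Sum>f\<in>G. \<Sum>w\<in>U. nonadj G w f) * r ^ r \<le> card U ^ Suc r) \<and>
    card G * r ^ r \<le> card U ^ r"
    using assms
  proof (induction r arbitrary: U G)
    case 0
    then show ?case by simp
  next
    case (Suc s)
    have finG: "finite G" using Suc.prems finite_subset[of G "Pow U"] by auto
    have finf: "finite f" if "f \<in> G" for f using that Suc.prems finite_subset by blast
    show ?case
    proof (cases "s = 0")
      \<comment> \<open>Here \<open>r = 1\<close>, where only the second bound is claimed: there are
        no more singletons than points.\<close>
      case True
      then have "G \<subseteq> {f. f \<subseteq> U \<and> card f = 1}" using Suc.prems by auto
      then have "card G \<le> card U choose 1"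
        using n_subsets[OF Suc.prems(1), of 1] Suc.prems(1)
          card_mono[of "{f. f \<subseteq> U \<and> card f = 1}" G] by simp
      then show ?thesis using True by simp
    next
      case s: False
      define n where "n = card U"
      define c where "c u = card {f \<in> G. u \<in> f}" for u
      define N where "N u = {w \<in> U. covered G u w}" for u
      have finN: "finite (N u)" and Nle: "card (N u) \<le> n" for u
        using Suc.prems(1) card_mono[of U "N u"] by (auto simp: N_def n_def)
      have c: "c u * s ^ s \<le> card (N u) ^ s" for u
      proof -
        have "card (link G u) * s ^ s \<le> card (N u) ^ s"
        proof (rule conjunct2[OF Suc.IH])
          show "\<not> covers_clique (Suc s) (link G u)"
            using covers_clique_link[of "Suc s" G u] s Suc.prems(4) by auto
          show "f \<subseteq> N u \<and> card f = s" if "f \<in> link G u" for f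
          proof -
            have f: "u \<notin> f" "insert u f \<in> G" using that by (auto simp: mem_link)
            then have "finite f" using finf by (metis finite_insert)
            then have "card f = s" using f Suc.prems(3)[OF f(2)] by simp
            moreover have "f \<subseteq> N u" using f Suc.prems(3)[OF f(2)] by (auto simp: N_def covered_def)
            ultimately show ?thesis by simp
          qed
        qed (use finN s in auto)
        then show ?thesis by (simp add: card_link c_def)
      qed
      have amgm: "c u * (n - card (N u)) * Suc s ^ Suc s \<le> n ^ Suc s" for u
      proof -
        let ?d = "card (N u)"
        have "real (n - ?d) * real ?d ^ s * real (Suc s) ^ Suc s \<le> real s ^ s * (real (n - ?d) + real ?d) ^ Suc s"
          by (rule weighted_am_gm) auto
        also have "real (n - ?d) + real ?d = real n" using Nle[of u] by simp
        finally have "(n - ?d) * ?d ^ s * Suc s ^ Suc s \<le> s ^ s * n ^ Suc s"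
          by (simp only: of_nat_le_iff flip: of_nat_mult of_nat_power)
        then have "(n - ?d) * Suc s ^ Suc s * ?d ^ s \<le> s ^ s * n ^ Suc s" by (simp only: mult_ac)
        moreover have "(n - ?d) * Suc s ^ Suc s * (c u * s ^ s) \<le> (n - ?d) * Suc s ^ Suc s * ?d ^ s"
          using c by (rule mult_le_mono2)
        ultimately have "s ^ s * (c u * (n - ?d) * Suc s ^ Suc s) \<le> s ^ s * n ^ Suc s"
          by (simp only: mult_ac)
        then show ?thesis using s by (metis mult_le_cancel1 zero_less_power neq0_conv)
      qed
      have "(\<Sum>f\<in>G. \<Sum>w\<in>U. nonadj G w f) = (\<Sum>f\<in>G. \<Sum>u\<in>f. n - card (N u))"
      proof (rule sum.cong[OF refl])
        fix f assume f: "f \<in> G"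
        have "(\<Sum>w\<in>U. card {u \<in> f. \<not> covered G u w}) = (\<Sum>u\<in>f. card {w \<in> U. \<not> covered G u w})"
          by (rule sum_multicount_gen) (use finf[OF f] Suc.prems(1) in auto)
        also have "\<dots> = (\<Sum>u\<in>f. n - card (N u))"
        proof (rule sum.cong[OF refl])
          fix u
          have "{w \<in> U. \<not> covered G u w} = U - N u" by (auto simp: N_def)
          then show "card {w \<in> U. \<not> covered G u w} = n - card (N u)"
            using finN by (simp add: card_Diff_subset N_def n_def)
        qed
        finally show "(\<Sum>w\<in>U. nonadj G w f) = (\<Sum>u\<in>f. n - card (N u))" by (simp add: nonadj_def)
      qed
      also have "\<dots> = (\<Sum>f\<in>G. \<Sum>u\<in>U. if u \<in> f then n - card (N u) else 0)"
      proof (rule sum.cong[OF refl])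
        fix f assume "f \<in> G"
        then have "U \<inter> f = f" using Suc.prems(3) by blast
        then show "(\<Sum>u\<in>f. n - card (N u)) = (\<Sum>u\<in>U. if u \<in> f then n - card (N u) else 0)"
          using Suc.prems(1) by (simp add: sum.If_cases)
      qed
      also have "\<dots> = (\<Sum>u\<in>U. \<Sum>f\<in>G. if u \<in> f then n - card (N u) else 0)" by (rule sum.swap)
      also have "\<dots> = (\<Sum>u\<in>U. c u * (n - card (N u)))"
        using finG by (intro sum.cong refl) (simp add: sum.If_cases c_def Int_def)
      finally have "(\<Sum>f\<in>G. \<Sum>w\<in>U. nonadj G w f) * Suc s ^ Suc s
          = (\<Sum>u\<in>U. c u * (n - card (N u)) * Suc s ^ Suc s)"
        by (simp only: sum_distrib_right)
      also have "\<dots> \<le> n * n ^ Suc s"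
        using sum_bounded_above[of U _ "n ^ Suc s"] amgm by (simp add: n_def)
      finally have 1: "(\<Sum>f\<in>G. \<Sum>w\<in>U. nonadj G w f) * Suc s ^ Suc s \<le> n ^ Suc (Suc s)" by simp
      have "card G * n \<le> (\<Sum>f\<in>G. \<Sum>w\<in>U. nonadj G w f)"
      proof -
        have "n \<le> (\<Sum>w\<in>U. nonadj G w f)" if "f \<in> G" for f
          using sum_mono[of U "\<lambda>_. 1" "\<lambda>w. nonadj G w f"] nonadj_ge_1[OF Suc.prems(4) that finf[OF that]]
            Suc.prems(3)[OF that] by (simp add: n_def)
        from sum_mono[of G "\<lambda>_. n", OF this] show ?thesis by simp
      qed
      then have "card G * n * Suc s ^ Suc s \<le> n ^ Suc (Suc s)"
        using 1 by (meson le_trans mult_le_mono1)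
      then have 2: "n * (card G * Suc s ^ Suc s) \<le> n * n ^ Suc s" by (simp add: mult_ac)
      have "card G * Suc s ^ Suc s \<le> n ^ Suc s"
      proof (cases "n = 0")
        case True
        then have "U = {}" using Suc.prems(1) by (simp add: n_def)
        then have "G = {}" using Suc.prems(3) by force
        then show ?thesis by simp
      next
        case False
        then show ?thesis using 2 by simp
      qed
      then show ?thesis using 1 by (simp add: n_def)
    qed
  qed
  then show "r \<ge> 2 \<Longrightarrow> (\<Sum>f\<in>G. \<Sum>w\<in>U. nonadj G w f) * r ^ r \<le> card U ^ Suc r"
    and "card G * r ^ r \<le> card U ^ r" by auto
qed

lemma card_subsets_le:
  assumes "finite V" "E \<subseteq> {e. e \<subseteq> V \<and> card e = k}"
  shows "finite E" "card E * fact k \<le> card V ^ k"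
proof -
  show "finite E" using assms finite_subset[of E "Pow V"] by auto
  have "card E \<le> card V choose k"
    using n_subsets[OF assms(1), of k] card_mono[OF _ assms(2)] assms(1) by simp
  then show "card E * fact k \<le> card V ^ k"
    using binomial_fact_pow[of "card V" k] by (meson le_trans mult_le_mono1)
qed

text \<open>Suppose some \<open>u\<close> in \<open>f\<close> were covered with \<open>w\<close> in
  the link of \<open>v\<close>. In the link of \<open>u\<close> consider \<open>f\<close> with
  \<open>u\<close> replaced by \<open>v\<close>: there \<open>w\<close> is covered with
  \<open>v\<close> by assumption and with the rest of \<open>f\<close> through
  \<open>insert w f\<close>, against \<open>nonadj_ge_1\<close>.\<close>

lemma nonadj_link_full:
  assumes k: "\<And>e. e \<in> E \<Longrightarrow> finite e \<and> card e = Suc r"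
    and free: "\<And>u. \<not> covers_clique (Suc r) (link E u)" and r: "r \<ge> 2"
    and f: "v \<notin> f" "insert v f \<in> E" and w: "w \<notin> f" "insert w f \<in> E"
  shows "nonadj (link E v) w f = r"
proof -
  have finf: "finite f" and cardf: "card f = r" using k[OF f(2)] f(1) by auto
  have "\<not> covered (link E v) u w" if u: "u \<in> f" for u
  proof
    assume cov: "covered (link E v) u w"
    then have "v \<noteq> w" by (auto simp: covered_link_iff)
    let ?g = "insert v (f - {u})"
    have "insert u ?g = insert v f" using u by blast
    moreover have "u \<notin> ?g" using f(1) u by blast
    ultimately have "?g \<in> link E u" using f(2) by (simp only: mem_link simp_thms)
    moreover have "finite ?g" using finf by simp
    moreover have "card ?g = r" using u f(1) finf cardf r by simp
    ultimately have "1 \<le> nonadj (link E u) w ?g" by (intro nonadj_ge_1[OF free])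
    then obtain x where x: "x \<in> ?g" "\<not> covered (link E u) x w"
      unfolding nonadj_def by (metis (no_types, lifting) card.empty empty_Collect_eq not_one_le_zero)
    show False
    proof (cases "x = v")
      case True
      moreover have "covered (link E u) v w" using cov unfolding covered_link_iff by blast
      ultimately show False using x(2) by simp
    next
      case False
      then have "x \<in> f" "x \<noteq> u" using x(1) by auto
      moreover from this have "x \<noteq> w" "u \<noteq> w" using w(1) u by blast+
      ultimately have "covered (link E u) x w"
        unfolding covered_link_iff using u w(2)
        by (intro conjI bexI[of _ "insert w f"]) auto
      then show False using x(2) by simp
    qed
  qed
  then have "{u \<in> f. \<not> covered (link E v) u w} = f" by auto
  then show ?thesis using cardf by (simp add: nonadj_def)
qed

text \<open>Two edges \<open>f \<union> {v}\<close> and \<open>f \<union> {w}\<close> make \<open>w\<close> non-adjacent to all of \<open>f\<close> in the link of \<open>v\<close>;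
  this waste produces the quadratic term.\<close>
lemma clique_free_links_quadratic:
  assumes V: "finite V" and E: "E \<subseteq> {e. e \<subseteq> V \<and> card e = Suc r}" and r: "r \<ge> 2"
    and free: "\<And>v. v \<in> V \<Longrightarrow> \<not> covers_clique (Suc r) (link E v)"
  defines "y \<equiv> real (Suc r) * real (card E) * real r ^ r" and "n \<equiv> real (card V)"
  shows "y * n ^ Suc r + real (r - 1) * (fact r / real r ^ r) * y ^ 2 \<le> n ^ (2 * Suc r)"
proof -
  have finE: "finite E" using card_subsets_le[OF V E] by simp
  have kE: "finite e \<and> card e = Suc r" if "e \<in> E" for e
    using that E finite_subset[OF _ V] by auto
  \<comment> \<open>Vertices outside \<open>V\<close> have empty links, so the hypothesis extends to
    all vertices, as \<open>nonadj_link_full\<close> demands.\<close>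
  have free': "\<not> covers_clique (Suc r) (link E u)" for u
  proof (cases "u \<in> V")
    case False
    then have emp: "link E u = {}" using E by (auto simp: link_def)
    show ?thesis
    proof
      assume "covers_clique (Suc r) (link E u)"
      then obtain X where X: "card X = Suc r" "\<forall>x\<in>X. \<forall>y\<in>X. x \<noteq> y \<longrightarrow> covered (link E u) x y"
        unfolding covers_clique_def by blast
      have "X \<noteq> {}" using X(1) by auto
      then obtain x where "x \<in> X" by blast
      then have "X \<subseteq> {x}" using X(2) by (auto simp: covered_def emp)
      then show False using X(1) r card_mono[of "{x}" X] by simp
    qed
  qed (use free in auto)
  define S where "S = {f. f \<subseteq> V \<and> card f = r}"
  \<comment> \<open>The codegree of an \<open>r\<close>-set. Its sum is fixed by the number of
    edges; its squares appear when the edges of all links are weighted by codegree.\<close>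
  define d where "d f = card {v \<in> V. v \<notin> f \<and> insert v f \<in> E}" for f
  have finS: "finite S" using V by (simp add: S_def)
  have fin_link: "finite (link E v)" for v using finE by (simp add: link_def)
  have link_sub: "f \<subseteq> V \<and> card f = r \<and> finite f" if "f \<in> link E v" for f v
  proof -
    from that have f: "v \<notin> f" "insert v f \<in> E" by (simp_all add: mem_link)
    have "finite (insert v f)" "card (insert v f) = Suc r" "insert v f \<subseteq> V"
      using kE[OF f(2)] subsetD[OF E f(2)] by simp_all
    then show ?thesis using f(1) by simp
  qed
  have link_eq: "link E v = {f \<in> S. v \<notin> f \<and> insert v f \<in> E}" for v
  proof (rule set_eqI)
    fix f
    show "f \<in> link E v \<longleftrightarrow> f \<in> {f \<in> S. v \<notin> f \<and> insert v f \<in> E}"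
      using mem_link[of f E v] link_sub[of f v] by (auto simp only: S_def mem_Collect_eq)
  qed
  have handshake: "(\<Sum>v\<in>V. card (link E v)) = Suc r * card E"
    unfolding card_link
  proof (rule sum_multicount[OF V finE], intro ballI)
    fix e assume e: "e \<in> E"
    then have "{v \<in> V. v \<in> e} = e" using E by auto
    then show "card {v \<in> V. v \<in> e} = Suc r" using kE[OF e] by simp
  qed
  have sumd: "(\<Sum>f\<in>S. d f) = Suc r * card E"
  proof -
    have "(\<Sum>v\<in>V. card (link E v)) = (\<Sum>v\<in>V. card {f \<in> S. v \<notin> f \<and> insert v f \<in> E})"
    proof (rule sum.cong[OF refl])
      fix v
      show "card (link E v) = card {f \<in> S. v \<notin> f \<and> insert v f \<in> E}" by (simp only: link_eq)
    qed
    also have "\<dots> = (\<Sum>f\<in>S. d f)"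
      unfolding d_def by (rule sum_multicount_gen) (use V finS in auto)
    finally show ?thesis using handshake by simp
  qed
  have sumd2: "(\<Sum>v\<in>V. \<Sum>f\<in>link E v. d f) = (\<Sum>f\<in>S. d f ^ 2)"
  proof -
    have "(\<Sum>v\<in>V. \<Sum>f\<in>link E v. d f) = (\<Sum>v\<in>V. \<Sum>f\<in>S. if v \<notin> f \<and> insert v f \<in> E then d f else 0)"
    proof (rule sum.cong[OF refl])
      fix v
      show "(\<Sum>f\<in>link E v. d f) = (\<Sum>f\<in>S. if v \<notin> f \<and> insert v f \<in> E then d f else 0)"
        unfolding link_eq sum.If_cases[OF finS] by (simp add: Int_def)
    qed
    also have "\<dots> = (\<Sum>f\<in>S. \<Sum>v\<in>V. if v \<notin> f \<and> insert v f \<in> E then d f else 0)" by (rule sum.swap)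
    also have "\<dots> = (\<Sum>f\<in>S. d f ^ 2)"
    proof (rule sum.cong[OF refl])
      fix f
      show "(\<Sum>v\<in>V. if v \<notin> f \<and> insert v f \<in> E then d f else 0) = d f ^ 2"
        using V unfolding sum.If_cases[OF V] by (simp add: d_def Int_def power2_eq_square)
    qed
    finally show ?thesis .
  qed
  \<comment> \<open>Every \<open>w\<close> counts at least 1, and the \<open>d f\<close> vertices
    \<open>w\<close> completing \<open>f\<close> to an edge count \<open>r\<close>.\<close>
  have low: "card V + (r - 1) * d f \<le> (\<Sum>w\<in>V. nonadj (link E v) w f)" if f: "f \<in> link E v" for v f
  proof -
    have "card V + (r - 1) * d f = (\<Sum>w\<in>V. 1 + (if w \<notin> f \<and> insert w f \<in> E then r - 1 else 0))"
      unfolding sum.distrib sum.If_cases[OF V] by (simp add: d_def Int_def)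
    also have "\<dots> \<le> (\<Sum>w\<in>V. nonadj (link E v) w f)"
    proof (rule sum_mono)
      fix w
      show "1 + (if w \<notin> f \<and> insert w f \<in> E then r - 1 else 0) \<le> nonadj (link E v) w f"
      proof (cases "w \<notin> f \<and> insert w f \<in> E")
        case True
        then have "nonadj (link E v) w f = r"
          using nonadj_link_full[OF kE free' r, of v f w] f by (simp add: mem_link)
        then show ?thesis using True r by simp
      next
        case False
        then show ?thesis using nonadj_ge_1[OF free' f] link_sub[OF f] by auto
      qed
    qed
    finally show ?thesis .
  qed
  have up: "(\<Sum>f\<in>link E v. card V + (r - 1) * d f) * r ^ r \<le> card V ^ Suc r" for v
  proof -
    have "(\<Sum>f\<in>link E v. card V + (r - 1) * d f) \<le> (\<Sum>f\<in>link E v. \<Sum>w\<in>V. nonadj (link E v) w f)"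
      using low by (rule sum_mono)
    moreover have "(\<Sum>f\<in>link E v. \<Sum>w\<in>V. nonadj (link E v) w f) * r ^ r \<le> card V ^ Suc r"
      using r link_sub free' by (intro sum_nonadj_le[OF V]) auto
    ultimately show ?thesis by (meson le_trans mult_le_mono1)
  qed
  have "(\<Sum>v\<in>V. (\<Sum>f\<in>link E v. card V + (r - 1) * d f) * r ^ r) \<le> card V * card V ^ Suc r"
    using sum_bounded_above[of V _ "card V ^ Suc r"] up by simp
  moreover have "(\<Sum>v\<in>V. (\<Sum>f\<in>link E v. card V + (r - 1) * d f) * r ^ r)
      = (card V * (Suc r * card E) + (r - 1) * (\<Sum>f\<in>S. d f ^ 2)) * r ^ r"
  proof -
    have "(\<Sum>f\<in>link E v. card V + (r - 1) * d f)
        = card V * card (link E v) + (r - 1) * (\<Sum>f\<in>link E v. d f)" for v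
      by (simp add: sum.distrib sum_distrib_left mult.commute)
    then have "(\<Sum>v\<in>V. (\<Sum>f\<in>link E v. card V + (r - 1) * d f) * r ^ r)
        = (\<Sum>v\<in>V. card V * card (link E v) + (r - 1) * (\<Sum>f\<in>link E v. d f)) * r ^ r"
      by (simp only: sum_distrib_right)
    also have "\<dots> = (card V * (\<Sum>v\<in>V. card (link E v))
        + (r - 1) * (\<Sum>v\<in>V. \<Sum>f\<in>link E v. d f)) * r ^ r"
      by (simp only: sum.distrib sum_distrib_left)
    finally show ?thesis by (simp only: handshake sumd2)
  qed
  ultimately have le: "(card V * (Suc r * card E) + (r - 1) * (\<Sum>f\<in>S. d f ^ 2)) * r ^ r
      \<le> card V * card V ^ Suc r" by (simp only:)
  have main: "n * y + real (r - 1) * (\<Sum>f\<in>S. real (d f) ^ 2) * real r ^ r \<le> n ^ Suc (Suc r)"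
  proof -
    have "real ((card V * (Suc r * card E) + (r - 1) * (\<Sum>f\<in>S. d f ^ 2)) * r ^ r)
        = n * y + real (r - 1) * (\<Sum>f\<in>S. real (d f) ^ 2) * real r ^ r"
      unfolding of_nat_mult of_nat_add of_nat_sum of_nat_power y_def n_def
      by (simp only: distrib_left distrib_right mult_ac)
    moreover have "real (card V * card V ^ Suc r) = n ^ Suc (Suc r)" by (simp add: n_def)
    ultimately show ?thesis using of_nat_mono[OF le, where 'a = real] by (simp only:)
  qed
  have "(\<Sum>f\<in>S. real (d f)) = real (Suc r) * real (card E)"
    using sumd by (metis of_nat_mult of_nat_sum)
  \<comment> \<open>Cauchy-Schwarz turns the squared codegrees into a term quadratic in the number
    of edges.\<close>
  then have cs: "(real (Suc r) * real (card E)) ^ 2 \<le> real (card S) * (\<Sum>f\<in>S. real (d f) ^ 2)"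
    using Cauchy_Schwarz_ineq_sum[of "\<lambda>_. 1" "\<lambda>f. real (d f)" S] by simp
  have "card S * fact r \<le> card V ^ r" using card_subsets_le[OF V, of S r] by (simp add: S_def)
  then have cardS: "real (card S) * fact r \<le> n ^ r"
    by (metis n_def of_nat_fact of_nat_le_iff of_nat_mult of_nat_power)
  define T where "T = (\<Sum>f\<in>S. real (d f) ^ 2)"
  have T: "T \<ge> 0" by (simp add: T_def sum_nonneg)
  have r0: "real r ^ r > 0" using r by simp
  have "fact r / real r ^ r * y ^ 2 = fact r * real r ^ r * (real (Suc r) * real (card E)) ^ 2"
    using r0 by (simp add: y_def power2_eq_square)
  also have "\<dots> \<le> fact r * real r ^ r * (real (card S) * T)"
    using cs by (intro mult_left_mono) (auto simp: T_def)
  also have "\<dots> = real (card S) * fact r * (real r ^ r * T)" by (simp only: mult_ac)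
  also have "\<dots> \<le> n ^ r * (real r ^ r * T)" using cardS T r0 by (intro mult_right_mono) auto
  finally have "real (r - 1) * (fact r / real r ^ r * y ^ 2) \<le> real (r - 1) * (n ^ r * (real r ^ r * T))"
    by (intro mult_left_mono) auto
  then have "y * n ^ Suc r + real (r - 1) * (fact r / real r ^ r) * y ^ 2
      \<le> n ^ r * (n * y) + real (r - 1) * (n ^ r * (real r ^ r * T))"
    by (simp add: mult_ac)
  also have "\<dots> = n ^ r * (n * y + real (r - 1) * T * real r ^ r)"
    by (simp only: distrib_left mult_ac)
  also have "\<dots> \<le> n ^ r * n ^ Suc (Suc r)"
    using main by (intro mult_left_mono) (auto simp: T_def n_def)
  also have "\<dots> = n ^ (2 * Suc r)"
    unfolding power_add[symmetric] by (rule arg_cong[where f = "\<lambda>m. n ^ m"]) simp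
  finally show ?thesis .
qed

section \<open>Iterated deletion of vertices with clique-free links\<close>

definition induced :: "'a set set \<Rightarrow> 'a set \<Rightarrow> 'a set set" where
  "induced E W = {e \<in> E. e \<subseteq> W}"

lemma finite_induced: "finite W \<Longrightarrow> finite (induced E W)"
  by (rule finite_subset[of _ "Pow W"]) (auto simp: induced_def)

text \<open>The survivors of one round of deletion. Links are taken inside \<open>W\<close>, so
  iteration evaluates them anew among the survivors.\<close>

definition rich :: "nat \<Rightarrow> 'a set set \<Rightarrow> 'a set \<Rightarrow> 'a set" where
  "rich r E W = {v \<in> W. covers_clique (Suc r) (link (induced E W) v)}"

lemma rich_subset: "rich r E W \<subseteq> W"
  by (auto simp: rich_def)

lemma covers_clique_mono:
  assumes "covers_clique s G" "G \<subseteq> G'"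
  shows "covers_clique s G'"
proof -
  obtain X where "finite X" "card X = s" "\<forall>x\<in>X. \<forall>y\<in>X. x \<noteq> y \<longrightarrow> covered G x y"
    using assms(1) unfolding covers_clique_def by blast
  moreover have "covered G' x y" if "covered G x y" for x y
    using that assms(2) unfolding covered_def by blast
  ultimately show ?thesis unfolding covers_clique_def by blast
qed

text \<open>Links only shrink when vertices are deleted, so a clique-free link stays clique-free
  throughout a deletion one by one.\<close>

lemma covers_clique_link_mono:
  assumes "\<not> covers_clique s (link (induced E W) v)" "U \<subseteq> W"
  shows "\<not> covers_clique s (link (induced E U) v)"
proof -
  have "link (induced E U) v \<subseteq> link (induced E W) v"
    using assms(2) by (auto simp: link_def induced_def)
  then show ?thesis using assms(1) covers_clique_mono by blast
qed

text \<open>Factor the difference of powers, in \<open>int\<close>. In \<open>induced_peel\<close>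
  the drop of \<open>card W ^ Suc r\<close> pays for the edges lost with a vertex.\<close>

lemma power_Suc_diff_ge: "Suc r * n ^ r + n ^ Suc r \<le> Suc n ^ Suc r"
proof -
  have "(\<Sum>i\<le>r. Suc n ^ i * n ^ (r - i)) \<ge> (\<Sum>i\<le>r. n ^ r)"
  proof (rule sum_mono)
    fix i assume "i \<in> {..r}"
    then have "n ^ r = n ^ i * n ^ (r - i)" by (simp flip: power_add)
    also have "\<dots> \<le> Suc n ^ i * n ^ (r - i)" by (intro mult_le_mono1 power_mono) auto
    finally show "n ^ r \<le> Suc n ^ i * n ^ (r - i)" .
  qed
  then have "int (Suc r * n ^ r) \<le> int (\<Sum>i\<le>r. Suc n ^ i * n ^ (r - i))"
    by (simp only: of_nat_le_iff sum_constant card_atMost of_nat_id)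
  also have "\<dots> = (\<Sum>i<Suc r. int n ^ (Suc r - Suc i) * int (Suc n) ^ i)"
    unfolding lessThan_Suc_atMost of_nat_sum by (intro sum.cong) (simp_all add: mult.commute)
  also have "\<dots> = int (Suc n) ^ Suc r - int n ^ Suc r"
    unfolding power_diff_sumr2 by simp
  finally have "int (Suc r * n ^ r + n ^ Suc r) \<le> int (Suc n ^ Suc r)"
    by (simp only: of_nat_add of_nat_power)
  then show ?thesis by (simp only: of_nat_le_iff)
qed

text \<open>Deleting the vertices outside \<open>U\<close> one at a time makes the bounds telescope.\<close>
lemma induced_peel:
  assumes "finite W" "U \<subseteq> W" and E: "\<And>e. e \<in> E \<Longrightarrow> finite e \<and> card e = Suc r" and r: "r \<ge> 2"
    and free: "\<And>v. v \<in> W - U \<Longrightarrow> \<not> covers_clique (Suc r) (link (induced E W) v)"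
  shows "Suc r * r ^ r * card (induced E W) + card U ^ Suc r
    \<le> card W ^ Suc r + Suc r * r ^ r * card (induced E U)"
  using assms(1,2) free
proof (induction "card (W - U)" arbitrary: W)
  case 0
  then have "W = U" by auto
  then show ?case by simp
next
  case (Suc m)
  then have "W - U \<noteq> {}" by auto
  then obtain v where v: "v \<in> W - U" by blast
  define W' where "W' = W - {v}"
  have W': "finite W'" "U \<subseteq> W'" "card W = Suc (card W')"
    using Suc.prems(1,2) v card.remove[of W v] by (auto simp: W'_def)
  have "W' - U = (W - U) - {v}" by (auto simp: W'_def)
  then have "m = card (W' - U)" using Suc.hyps(2) Suc.prems(1) v by simp
  moreover have "\<not> covers_clique (Suc r) (link (induced E W') u)" if "u \<in> W' - U" for u
    using covers_clique_link_mono[OF Suc.prems(3)[of u], of W'] that by (auto simp: W'_def)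
  ultimately have IH: "Suc r * r ^ r * card (induced E W') + card U ^ Suc r
      \<le> card W' ^ Suc r + Suc r * r ^ r * card (induced E U)"
    using Suc.hyps(1)[of W'] W'(1,2) by simp
  let ?L = "link (induced E W) v"
  have fin: "finite (induced E W)"
    using Suc.prems(1) by (rule finite_induced)
  \<comment> \<open>The edges at \<open>v\<close> correspond to those of its link on
    \<open>W'\<close>, which obeys the extremal bound because \<open>v\<close> is outside
    \<open>U\<close>.\<close>
  have "card ?L * r ^ r \<le> card W' ^ r"
  proof (rule card_clique_free_le[OF W'(1)])
    show "\<not> covers_clique (Suc r) ?L" using Suc.prems(3)[OF v] .
    fix f assume "f \<in> ?L"
    then have f: "v \<notin> f" "insert v f \<in> E" "insert v f \<subseteq> W" by (auto simp: mem_link induced_def)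
    have "finite (insert v f)" "card (insert v f) = Suc r" using E[OF f(2)] by auto
    then show "f \<subseteq> W' \<and> card f = r" using f by (auto simp: W'_def)
  qed (use r in simp)
  then have L: "Suc r * r ^ r * card ?L \<le> Suc r * card W' ^ r"
    using mult_le_mono2[of "card ?L * r ^ r" "card W' ^ r" "Suc r"] by (simp only: mult_ac)
  have "induced E W = induced E W' \<union> {e \<in> induced E W. v \<in> e}"
    by (auto simp: induced_def W'_def)
  moreover have "induced E W' \<inter> {e \<in> induced E W. v \<in> e} = {}"
    by (auto simp: induced_def W'_def)
  moreover have "finite (induced E W')"
    using W'(1) by (rule finite_induced)
  ultimately have "card (induced E W) = card (induced E W') + card ?L"
    using fin card_Un_disjoint[of "induced E W'" "{e \<in> induced E W. v \<in> e}"] by (simp add: card_link)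
  then have "Suc r * r ^ r * card (induced E W) + card U ^ Suc r
      = Suc r * r ^ r * card (induced E W') + card U ^ Suc r + Suc r * r ^ r * card ?L"
    by (simp add: distrib_left)
  also have "\<dots> \<le> card W' ^ Suc r + Suc r * r ^ r * card (induced E U) + Suc r * card W' ^ r"
    using IH L by linarith
  also have "\<dots> \<le> card W ^ Suc r + Suc r * r ^ r * card (induced E U)"
    using power_Suc_diff_ge[of r "card W'"] W'(3) by simp
  finally show ?case .
qed

text \<open>An edge in \<open>W\<close> that meets \<open>U\<close> belongs to the star of a vertex
  of \<open>U\<close>, and a star has at most \<open>card W ^ r\<close> edges.\<close>

lemma card_induced_le_induced_diff:
  assumes "finite W" "U \<subseteq> W" and E: "\<And>e. e \<in> E \<Longrightarrow> finite e \<and> card e = Suc r"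
  shows "card (induced E W) \<le> card (induced E (W - U)) + card U * card W ^ r"
proof -
  have fin: "finite (induced E X)" if "X \<subseteq> W" for X
    using finite_subset[OF that assms(1)] by (rule finite_induced)
  have star: "card {e \<in> induced E W. v \<in> e} \<le> card W ^ r" for v
  proof -
    let ?L = "link (induced E W) v"
    have "?L \<subseteq> {f. f \<subseteq> W \<and> card f = r}"
    proof
      fix f assume "f \<in> ?L"
      then have f: "v \<notin> f" "insert v f \<in> E" "insert v f \<subseteq> W" by (auto simp: mem_link induced_def)
      have "finite (insert v f)" "card (insert v f) = Suc r" using E[OF f(2)] by auto
      then show "f \<in> {f. f \<subseteq> W \<and> card f = r}" using f by auto
    qed
    from card_subsets_le(2)[OF assms(1) this] have "card ?L * fact r \<le> card W ^ r" .
    then have "card ?L \<le> card W ^ r"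
      using fact_ge_1[of r, where 'a = nat] by (metis le_trans mult_le_mono2 nat_mult_1_right)
    then show ?thesis by (simp add: card_link)
  qed
  have "induced E W \<subseteq> induced E (W - U) \<union> (\<Union>v\<in>U. {e \<in> induced E W. v \<in> e})"
    by (auto simp: induced_def)
  moreover have finU: "finite U" using assms finite_subset by blast
  ultimately have "card (induced E W)
      \<le> card (induced E (W - U) \<union> (\<Union>v\<in>U. {e \<in> induced E W. v \<in> e}))"
    using fin by (intro card_mono) auto
  also have "\<dots> \<le> card (induced E (W - U)) + card (\<Union>v\<in>U. {e \<in> induced E W. v \<in> e})"
    by (rule card_Un_le)
  also have "card (\<Union>v\<in>U. {e \<in> induced E W. v \<in> e}) \<le> (\<Sum>v\<in>U. card {e \<in> induced E W. v \<in> e})"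
    by (rule card_UN_le[OF finU])
  also have "\<dots> \<le> card U * card W ^ r" using sum_bounded_above[of U _ "card W ^ r"] star by simp
  finally show ?thesis by simp
qed

text \<open>The edge count \<open>y\<close> is scaled so that the bound on each single link yields
  \<open>y \<le> N\<close>. The inequality \<open>y * N + a * y ^ 2 \<le> N ^ 2\<close> fails near
  \<open>y = N\<close>, which gains a constant factor.\<close>

lemma clique_free_links_bound:
  assumes r: "r \<ge> 2"
  shows "\<exists>\<beta><1. 0 \<le> \<beta> \<and> (\<forall>(V :: 'a set) E. finite V \<longrightarrow> E \<subseteq> {e. e \<subseteq> V \<and> card e = Suc r} \<longrightarrow>
      (\<forall>v\<in>V. \<not> covers_clique (Suc r) (link E v)) \<longrightarrow>
      real (Suc r) * real r ^ r * real (card E) \<le> \<beta> * real (card V) ^ Suc r)"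
proof -
  define a where "a = real (r - 1) * (fact r / real r ^ r)"
  have a: "a > 0" using r by (simp add: a_def)
  \<comment> \<open>If \<open>y > \<beta> * N\<close>, the entry \<open>1 / 2\<close> gives
    \<open>a * y ^ 2 \<ge> a / 4 * N ^ 2\<close> and the entry \<open>1 - a / 4\<close> gives
    \<open>y * N > (1 - a / 4) * N ^ 2\<close>; the sum exceeds \<open>N ^ 2\<close>.\<close>
  define \<beta> where "\<beta> = max (1 / 2) (1 - a / 4)"
  have \<beta>: "\<beta> < 1" "\<beta> \<ge> 1 / 2" using a by (auto simp: \<beta>_def)
  show ?thesis
  proof (intro exI[of _ \<beta>] conjI allI impI)
    show "\<beta> < 1" "0 \<le> \<beta>" using \<beta> by auto
    fix V :: "'a set" and E
    assume V: "finite V" and E: "E \<subseteq> {e. e \<subseteq> V \<and> card e = Suc r}"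
      and free: "\<forall>v\<in>V. \<not> covers_clique (Suc r) (link E v)"
    define y where "y = real (Suc r) * real (card E) * real r ^ r"
    define N where "N = real (card V) ^ Suc r"
    have ineq: "y * N + a * y ^ 2 \<le> N ^ 2"
    proof -
      have "N ^ 2 = real (card V) ^ (2 * Suc r)"
        unfolding N_def power_mult[symmetric] by (simp only: mult.commute)
      then show ?thesis
        using clique_free_links_quadratic[OF V E r bspec[OF free]] by (simp only: y_def N_def a_def)
    qed
    have pos: "y \<ge> 0" "N \<ge> 0" by (simp_all add: y_def N_def)
    have "y \<le> \<beta> * N"
    proof (rule ccontr)
      assume "\<not> ?thesis"
      then have less: "\<beta> * N < y" by simp
      have half: "N / 2 \<le> y" using less mult_right_mono[OF \<beta>(2) pos(2)] by linarith
      have y0: "y > 0" using less mult_right_mono[OF \<beta>(2) pos(2)] pos(2) by linarith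
      have "(1 - a / 4) * N \<le> \<beta> * N" using pos(2) by (intro mult_right_mono) (auto simp: \<beta>_def)
      then have "N - a / 4 * N < y" using less by (simp add: algebra_simps)
      moreover have "N > 0"
      proof (rule ccontr)
        assume "\<not> N > 0"
        then have "N = 0" using pos by simp
        then have "a * y ^ 2 \<le> 0" using ineq by simp
        then show False using a y0 by (simp add: mult_le_0_iff)
      qed
      ultimately have "(N - a / 4 * N) * N < y * N" by simp
      moreover have "a * (N / 2) ^ 2 \<le> a * y ^ 2"
        using half pos a by (intro mult_left_mono power_mono) auto
      ultimately have "(N - a / 4 * N) * N + a * (N / 2) ^ 2 < N ^ 2" using ineq by linarith
      then show False by (simp add: power2_eq_square algebra_simps)
    qed
    then show "real (Suc r) * real r ^ r * real (card E) \<le> \<beta> * real (card V) ^ Suc r"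
      by (simp add: y_def N_def mult_ac)
  qed
qed

text \<open>Induction on \<open>t\<close>, with \<open>U\<close> the survivors of the first round.
  If \<open>U\<close> is small, drop it: all remaining links are clique-free at once. If
  \<open>U\<close> is large, peel down to \<open>U\<close>: the deficit inside \<open>U\<close>,
  known by induction, is a positive share of the whole. The constant depends on \<open>t\<close> but
  not on the hypergraph.\<close>

lemma rich_iterate_empty_bound:
  assumes r: "r \<ge> 2"
  shows "\<exists>\<beta><1. 0 \<le> \<beta> \<and> (\<forall>(W :: 'a set) E. finite W \<longrightarrow> (\<forall>e\<in>E. finite e \<and> card e = Suc r) \<longrightarrow>
    (rich r E ^^ t) W = {} \<longrightarrow>
    real (Suc r) * real r ^ r * real (card (induced E W)) \<le> \<beta> * real (card W) ^ Suc r)"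
proof (induction t)
  case 0
  show ?case
  proof (intro exI[of _ 0] conjI allI impI)
    fix W :: "'a set" and E
    assume "\<forall>e\<in>E. finite e \<and> card e = Suc r" "(rich r E ^^ 0) W = {}"
    then have "induced E W = {}" by (auto simp: induced_def)
    then show "real (Suc r) * real r ^ r * real (card (induced E W)) \<le> 0 * real (card W) ^ Suc r"
      by simp
  qed auto
next
  case (Suc t)
  then obtain \<beta> where \<beta>: "\<beta> < 1" "0 \<le> \<beta>" and IH: "\<And>(W :: 'a set) E. finite W \<Longrightarrow>
    (\<forall>e\<in>E. finite e \<and> card e = Suc r) \<Longrightarrow> (rich r E ^^ t) W = {} \<Longrightarrow>
    real (Suc r) * real r ^ r * real (card (induced E W)) \<le> \<beta> * real (card W) ^ Suc r" by blast
  obtain \<gamma> where \<gamma>: "\<gamma> < 1" "0 \<le> \<gamma>" and all_poor: "\<And>(V :: 'a set) E. finite V \<Longrightarrow>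
      E \<subseteq> {e. e \<subseteq> V \<and> card e = Suc r} \<Longrightarrow>
      (\<forall>v\<in>V. \<not> covers_clique (Suc r) (link E v)) \<Longrightarrow>
      real (Suc r) * real r ^ r * real (card E) \<le> \<gamma> * real (card V) ^ Suc r"
    using clique_free_links_bound[OF r] by blast
  define C where "C = real (Suc r) * real r ^ r"
  have C: "C > 0" using r by (simp add: C_def)
  \<comment> \<open>Chosen with \<open>C * \<theta> = (1 - \<gamma>) / 2\<close>, so that restoring
    the at most \<open>u * w ^ r\<close> edges at a small \<open>U\<close> leaves the constant
    \<open>(1 + \<gamma>) / 2\<close>.\<close>
  define \<theta> where "\<theta> = (1 - \<gamma>) / (2 * C)"
  have \<theta>: "\<theta> > 0" using \<gamma> C by (simp add: \<theta>_def)
  \<comment> \<open>One entry for each case; for \<open>u > \<theta> * w\<close> the deficit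
    \<open>(1 - \<beta>) * u ^ Suc r\<close> is bounded below in terms of \<open>w\<close>.\<close>
  define \<beta>' where "\<beta>' = max ((1 + \<gamma>) / 2) (1 - (1 - \<beta>) * \<theta> ^ Suc r)"
  have "(1 - \<beta>) * \<theta> ^ Suc r > 0" using \<beta> \<theta> by simp
  then have \<beta>': "\<beta>' < 1" "0 \<le> \<beta>'" using \<gamma> by (auto simp: \<beta>'_def max_def)
  show ?case
  proof (intro exI[of _ \<beta>'] conjI allI impI)
    show "\<beta>' < 1" "0 \<le> \<beta>'" by (fact \<beta>')+
    fix W :: "'a set" and E
    assume W: "finite W" and E: "\<forall>e\<in>E. finite e \<and> card e = Suc r"
      and emp: "(rich r E ^^ Suc t) W = {}"
    define U where "U = rich r E W"
    have U: "U \<subseteq> W" unfolding U_def by (rule rich_subset)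
    have finU: "finite U" using U W by (rule finite_subset)
    have "(rich r E ^^ t) U = {}" using emp by (simp add: U_def funpow_swap1)
    from IH[OF finU E this] have eU: "C * real (card (induced E U)) \<le> \<beta> * real (card U) ^ Suc r"
      by (simp add: C_def)
    have poor: "\<not> covers_clique (Suc r) (link (induced E W) v)" if "v \<in> W - U" for v
      using that by (auto simp: U_def rich_def)
    have E': "finite e \<and> card e = Suc r" if "e \<in> E" for e using E that by blast
    define w where "w = real (card W)"
    define u where "u = real (card U)"
    have uw: "0 \<le> u" "u \<le> w" using card_mono[OF W U] by (simp_all add: u_def w_def)
    have "C * real (card (induced E W)) \<le> \<beta>' * w ^ Suc r"
    proof (cases "u \<le> \<theta> * w")
      case True
      have "C * real (card (induced E (W - U))) \<le> \<gamma> * real (card (W - U)) ^ Suc r"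
        unfolding C_def
      proof (rule all_poor)
        show "finite (W - U)" using W by simp
        show "induced E (W - U) \<subseteq> {e. e \<subseteq> W - U \<and> card e = Suc r}"
          using E by (auto simp: induced_def)
        show "\<forall>v\<in>W - U. \<not> covers_clique (Suc r) (link (induced E (W - U)) v)"
          using covers_clique_link_mono[OF poor] by blast
      qed
      also have "\<dots> \<le> \<gamma> * w ^ Suc r"
        using \<gamma> W by (intro mult_left_mono power_mono) (auto simp: w_def intro: card_mono)
      finally have 1: "C * real (card (induced E (W - U))) \<le> \<gamma> * w ^ Suc r" .
      have "real (card (induced E W)) \<le> real (card (induced E (W - U))) + u * w ^ r"
        using card_induced_le_induced_diff[OF W U E'] unfolding u_def w_def
        by (metis of_nat_add of_nat_le_iff of_nat_mult of_nat_power)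
      then have "C * real (card (induced E W)) \<le> C * (real (card (induced E (W - U))) + u * w ^ r)"
        using C by (intro mult_left_mono) auto
      also have "\<dots> \<le> \<gamma> * w ^ Suc r + C * (\<theta> * w * w ^ r)"
        using 1 True C uw unfolding distrib_left by (intro add_mono mult_left_mono mult_right_mono) auto
      also have "\<dots> = (\<gamma> + C * \<theta>) * w ^ Suc r" by (simp add: algebra_simps)
      also have "\<gamma> + C * \<theta> = (1 + \<gamma>) / 2" using C by (simp add: \<theta>_def field_simps)
      also have "(1 + \<gamma>) / 2 * w ^ Suc r \<le> \<beta>' * w ^ Suc r"
        using uw by (intro mult_right_mono) (auto simp: \<beta>'_def)
      finally show ?thesis .
    next
      case False
      have "Suc r * r ^ r * card (induced E W) + card U ^ Suc r
          \<le> card W ^ Suc r + Suc r * r ^ r * card (induced E U)"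
        by (rule induced_peel[OF W U E' r poor])
      from of_nat_mono[OF this, where 'a = real]
      have "C * real (card (induced E W)) + u ^ Suc r \<le> w ^ Suc r + C * real (card (induced E U))"
        unfolding of_nat_add of_nat_mult of_nat_power C_def u_def w_def .
      also have "\<dots> \<le> w ^ Suc r + \<beta> * u ^ Suc r" using eU by (simp add: u_def)
      finally have "C * real (card (induced E W)) \<le> w ^ Suc r - (1 - \<beta>) * u ^ Suc r"
        by (simp add: algebra_simps)
      also have "\<dots> \<le> w ^ Suc r - (1 - \<beta>) * (\<theta> * w) ^ Suc r"
        using False \<theta> uw \<beta> by (intro diff_left_mono mult_left_mono power_mono) auto
      also have "\<dots> = (1 - (1 - \<beta>) * \<theta> ^ Suc r) * w ^ Suc r"
        by (simp add: power_mult_distrib algebra_simps)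
      also have "\<dots> \<le> \<beta>' * w ^ Suc r"
        using uw by (intro mult_right_mono) (auto simp: \<beta>'_def)
      finally show ?thesis .
    qed
    then show "real (Suc r) * real r ^ r * real (card (induced E W)) \<le> \<beta>' * real (card W) ^ Suc r"
      by (simp add: C_def w_def)
  qed
qed

section \<open>Trees of expanded cliques\<close>

type_synonym expansion_vertex = "nat \<times> nat \<times> nat"

text \<open>The expansion of the complete graph on \<open>{..r}\<close>: the vertex \<open>a\<close> of the complete graph is
  \<open>(a, a, 0)\<close>, and the edge through \<open>a < b\<close> has the \<open>r - 2\<close> private vertices \<open>(a, b, i)\<close>.\<close>
definition expansion_edge :: "nat \<Rightarrow> nat \<Rightarrow> nat \<Rightarrow> expansion_vertex set" where
  "expansion_edge r a b = insert (a, a, 0) (insert (b, b, 0) ((\<lambda>i. (a, b, i)) ` {..<r - 2}))"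

definition expansion_edges :: "nat \<Rightarrow> expansion_vertex set set" where
  "expansion_edges r = {expansion_edge r a b | a b. a < b \<and> b \<le> r}"

text \<open>A vertex of the tree is the list of steps leading back to the root \<open>[]\<close>.\<close>
definition expansion_tree :: "nat \<Rightarrow> nat \<Rightarrow> expansion_vertex list hypergraph" where
  "expansion_tree r t = ({p. set p \<subseteq> \<Union> (expansion_edges r) \<and> length p \<le> t},
    {insert p ((\<lambda>j. j # p) ` e) | p e.
      set p \<subseteq> \<Union> (expansion_edges r) \<and> length p < t \<and> e \<in> expansion_edges r})"

lemma expansion_edge_card:
  assumes "r \<ge> 2" "a < b"
  shows "finite (expansion_edge r a b)" "card (expansion_edge r a b) = r"
proof -
  have "card ((\<lambda>i. (a, b, i)) ` {..<r - 2}) = r - 2" by (subst card_image) (auto simp: inj_on_def)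
  moreover have "(a, a, 0) \<notin> insert (b, b, 0) ((\<lambda>i. (a, b, i)) ` {..<r - 2})"
    "(b, b, 0) \<notin> (\<lambda>i. (a, b, i)) ` {..<r - 2}" using assms(2) by auto
  ultimately show "card (expansion_edge r a b) = r" using assms(1) by (simp add: expansion_edge_def)
qed (simp add: expansion_edge_def)

lemma finite_expansion_edges: "finite (expansion_edges r)"
proof -
  have "expansion_edges r \<subseteq> (\<lambda>(a, b). expansion_edge r a b) ` ({..r} \<times> {..r})"
    by (auto simp: expansion_edges_def)
  then show ?thesis by (rule finite_subset) simp
qed

lemma expansion_edges_memD:
  assumes "r \<ge> 2" "e \<in> expansion_edges r"
  shows "finite e" "card e = r"
  using assms expansion_edge_card by (auto simp: expansion_edges_def)

lemma kgraph_expansion_tree: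
  assumes "r \<ge> 2"
  shows "kgraph (Suc r) (expansion_tree r t)"
proof -
  have "finite (\<Union> (expansion_edges r))"
    using finite_expansion_edges expansion_edges_memD(1)[OF assms] by (intro finite_Union) auto
  then have fin: "finite (verts (expansion_tree r t))"
    using finite_lists_length_le by (simp add: expansion_tree_def)
  have card: "card (insert p ((\<lambda>j. j # p) ` e)) = Suc r" if "e \<in> expansion_edges r" for p e
  proof -
    have "p \<notin> (\<lambda>j. j # p) ` e" by auto
    moreover have "card ((\<lambda>j. j # p) ` e) = r"
      using expansion_edges_memD[OF assms that] by (subst card_image) (auto simp: inj_on_def)
    ultimately show ?thesis using expansion_edges_memD[OF assms that] by simp
  qed
  have "e' \<subseteq> verts (expansion_tree r t) \<and> card e' = Suc r" if "e' \<in> edges (expansion_tree r t)" for e'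
  proof -
    from that obtain p e where pe: "e' = insert p ((\<lambda>j. j # p) ` e)"
      "set p \<subseteq> \<Union> (expansion_edges r)" "length p < t" "e \<in> expansion_edges r"
      by (auto simp: expansion_tree_def)
    have "e \<subseteq> \<Union> (expansion_edges r)" using pe(4) by (rule Union_upper)
    then have "e' \<subseteq> verts (expansion_tree r t)"
      using pe(2,3) unfolding pe(1) expansion_tree_def by (auto simp del: Union_iff)
    then show ?thesis using card[OF pe(4)] pe(1) by simp
  qed
  then show ?thesis unfolding kgraph_def using fin by blast
qed

lemma expansion_tree_edges_nonempty:
  assumes "r \<ge> 2" "t > 0"
  shows "edges (expansion_tree r t) \<noteq> {}"
proof -
  have "expansion_edge r 0 1 \<in> expansion_edges r" unfolding expansion_edges_def
    using assms(1) by (intro CollectI exI[of _ 0] exI[of _ 1]) auto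
  then have "insert [] ((\<lambda>j. j # []) ` expansion_edge r 0 1) \<in> edges (expansion_tree r t)"
    unfolding expansion_tree_def snd_conv using assms(2)
    by (intro CollectI exI[of _ "[]"] exI[of _ "expansion_edge r 0 1"]) auto
  then show ?thesis by blast
qed

text \<open>The core goes to the clique, and the private vertices of the edge through
  \<open>a < b\<close> fill up an edge that covers the two images. These edges may overlap, so
  injectivity is not claimed.\<close>

lemma expansion_hom_of_clique:
  assumes "covers_clique (Suc r) G" and r: "r \<ge> 2" and G: "\<And>f. f \<in> G \<Longrightarrow> finite f \<and> card f = r"
  shows "\<exists>\<phi>. \<forall>e\<in>expansion_edges r. \<phi> ` e \<in> G"
proof -
  obtain X where X: "finite X" "card X = Suc r" "\<forall>x\<in>X. \<forall>y\<in>X. x \<noteq> y \<longrightarrow> covered G x y"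
    using assms(1) unfolding covers_clique_def by blast
  obtain x where x: "bij_betw x {..r} X"
    using ex_bij_betw_nat_finite[OF X(1)] X(2) by (auto simp: atLeast0LessThan lessThan_Suc_atMost)
  have "\<exists>f h. f \<in> G \<and> x a \<in> f \<and> x b \<in> f \<and> bij_betw h {..<r - 2} (f - {x a, x b})"
    if ab: "a < b" "b \<le> r" for a b
  proof -
    have ne: "x a \<noteq> x b" using x ab by (auto simp: bij_betw_def inj_on_def)
    have "x a \<in> X" "x b \<in> X" using x ab by (auto simp: bij_betw_def)
    then have "covered G (x a) (x b)" using X(3) ne by blast
    then obtain f where f: "f \<in> G" "x a \<in> f" "x b \<in> f" unfolding covered_def by blast
    have "card (f - {x a, x b}) = r - 2" using G[OF f(1)] f ne by (simp add: card_Diff_subset)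
    moreover have "finite (f - {x a, x b})" using G[OF f(1)] by simp
    ultimately obtain h where "bij_betw h {..<r - 2} (f - {x a, x b})"
      using ex_bij_betw_nat_finite by (metis atLeast0LessThan)
    then show ?thesis using f by blast
  qed
  then obtain f h where fh: "\<And>a b. a < b \<Longrightarrow> b \<le> r \<Longrightarrow>
      f a b \<in> G \<and> x a \<in> f a b \<and> x b \<in> f a b \<and> bij_betw (h a b) {..<r - 2} (f a b - {x a, x b})"
    by metis
  \<comment> \<open>Core vertices are recognised by equal first entries, as private vertices have
    \<open>a < b\<close>.\<close>
  define \<phi> where "\<phi> = (\<lambda>(a, b, i). if a = b then x a else h a b i)"
  have "\<phi> ` expansion_edge r a b \<in> G" if ab: "a < b" "b \<le> r" for a b
  proof -
    have "\<phi> ` expansion_edge r a b = insert (x a) (insert (x b) (h a b ` {..<r - 2}))"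
      using ab by (simp add: \<phi>_def expansion_edge_def image_image)
    also have "h a b ` {..<r - 2} = f a b - {x a, x b}" using fh[OF ab] by (simp add: bij_betw_def)
    also have "insert (x a) (insert (x b) (f a b - {x a, x b})) = f a b" using fh[OF ab] by blast
    finally show ?thesis using fh[OF ab] by simp
  qed
  then show ?thesis by (auto simp: expansion_edges_def)
qed

text \<open>Grow the tree from a vertex that survives \<open>t\<close> rounds. A vertex surviving
  \<open>i + 1\<close> rounds has an image of the expansion in its link among the survivors of
  \<open>i\<close> rounds, and this image receives its children.\<close>

lemma hom_of_rich_iterate:
  assumes r: "r \<ge> 2" and E: "\<And>e. e \<in> E \<Longrightarrow> finite e \<and> card e = Suc r"
    and ne: "(rich r E ^^ t) V \<noteq> {}"
  shows "hom_to (expansion_tree r t) (V, E)"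
proof -
  define R where "R i = (rich r E ^^ i) V" for i
  have R_Suc: "R (Suc i) = rich r E (R i)" for i by (simp add: R_def)
  have R_sub: "R i \<subseteq> V" for i
  proof (induction i)
    case (Suc i)
    then show ?case using rich_subset[of r E "R i"] by (simp add: R_Suc)
  qed (simp add: R_def)
  have "\<exists>\<phi>. \<forall>e\<in>expansion_edges r. \<phi> ` e \<in> link (induced E (R i)) v" if "v \<in> R (Suc i)" for i v
  proof (rule expansion_hom_of_clique[OF _ r])
    show "covers_clique (Suc r) (link (induced E (R i)) v)"
      using that by (simp add: R_Suc rich_def)
    fix f assume "f \<in> link (induced E (R i)) v"
    then have f: "v \<notin> f" "insert v f \<in> E" by (auto simp: mem_link induced_def)
    then show "finite f \<and> card f = r" using E[OF f(2)] by auto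
  qed
  note ex = this
  define \<phi> where "\<phi> i v = (SOME \<phi>. \<forall>e\<in>expansion_edges r. \<phi> ` e \<in> link (induced E (R i)) v)" for i v
  have \<phi>: "\<phi> i v ` e \<in> link (induced E (R i)) v"
    if "v \<in> R (Suc i)" "e \<in> expansion_edges r" for i v e
    using someI_ex[OF ex[OF that(1)]] that(2) unfolding \<phi>_def by blast
  obtain v0 where v0: "v0 \<in> R t" using ne by (auto simp: R_def)
  \<comment> \<open>A child is placed by the map chosen for the image of its parent
    \<open>p\<close>, so that depth \<open>d\<close> lands in \<open>R (t - d)\<close>.\<close>
  define f where "f = rec_list v0 (\<lambda>j p w. \<phi> (t - Suc (length p)) w j)"
  have f_simps: "f [] = v0" "f (j # p) = \<phi> (t - Suc (length p)) (f p) j" for j p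
    by (simp_all add: f_def)
  have fR: "f p \<in> R (t - length p)" if "set p \<subseteq> \<Union> (expansion_edges r)" "length p \<le> t" for p
    using that
  proof (induction p)
    case (Cons j p)
    then obtain e where e: "e \<in> expansion_edges r" "j \<in> e" by auto
    have "f p \<in> R (Suc (t - Suc (length p)))" using Cons by (simp add: Suc_diff_Suc)
    from \<phi>[OF this e(1)] e(2) show ?case
      by (auto simp: f_simps mem_link induced_def)
  qed (use v0 in \<open>simp add: f_simps\<close>)
  have "f ` verts (expansion_tree r t) \<subseteq> V"
    using fR R_sub by (auto simp: expansion_tree_def)
  moreover have "f ` e' \<in> E" if "e' \<in> edges (expansion_tree r t)" for e'
  proof -
    from that obtain p e where pe: "e' = insert p ((\<lambda>j. j # p) ` e)"
      "set p \<subseteq> \<Union> (expansion_edges r)" "length p < t" "e \<in> expansion_edges r"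
      by (auto simp: expansion_tree_def)
    have "f p \<in> R (Suc (t - Suc (length p)))" using fR[OF pe(2)] pe(3) by (simp add: Suc_diff_Suc)
    from \<phi>[OF this pe(4)]
    have "insert (f p) (\<phi> (t - Suc (length p)) (f p) ` e) \<in> E" by (auto simp: mem_link induced_def)
    moreover have "f ` e' = insert (f p) (\<phi> (t - Suc (length p)) (f p) ` e)"
      unfolding pe(1) by (simp add: image_image f_simps)
    ultimately show ?thesis by simp
  qed
  ultimately show ?thesis unfolding hom_to_def by auto
qed

text \<open>If the tree has no homomorphism to \<open>G\<close>, then \<open>t\<close> rounds delete
  all of \<open>G\<close>, and the bound for vanishing iterates applies. Its factor
  \<open>\<beta> < 1\<close> is the same for all \<open>G\<close>, so strictness survives the
  limit.\<close>

lemma turan_density_expansion_tree_less: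
  assumes r: "r \<ge> 2" and t: "t > 0"
  shows "turan_density (Suc r) (expansion_tree r t) < fact r / real r ^ r"
proof -
  let ?q = "fact r / real r ^ r"
  have q: "?q > 0" using r by simp
  obtain \<beta> where \<beta>: "\<beta> < 1" "0 \<le> \<beta>" and bound: "\<And>(W :: nat set) E. finite W \<Longrightarrow>
    (\<forall>e\<in>E. finite e \<and> card e = Suc r) \<Longrightarrow> (rich r E ^^ t) W = {} \<Longrightarrow>
    real (Suc r) * real r ^ r * real (card (induced E W)) \<le> \<beta> * real (card W) ^ Suc r"
    using rich_iterate_empty_bound[OF r, of t] by blast
  have "turan_density (Suc r) (expansion_tree r t) \<le> \<beta> * ?q"
  proof (rule turan_density_le_of_hom_free_bound[OF kgraph_expansion_tree[OF r]
        expansion_tree_edges_nonempty[OF r t]])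
    show "0 \<le> \<beta> * ?q" using \<beta> q by simp
    fix G :: "nat hypergraph"
    assume G: "kgraph (Suc r) G" and free: "\<not> hom_to (expansion_tree r t) G"
    have E: "finite e \<and> card e = Suc r" if "e \<in> edges G" for e
      using kgraphD(4,5)[OF G that] by simp
    have "(rich r (edges G) ^^ t) (verts G) = {}"
      using hom_of_rich_iterate[OF r, of "edges G" t "verts G"] E free by auto
    then have "real (Suc r) * real r ^ r * real (card (induced (edges G) (verts G)))
        \<le> \<beta> * real (card (verts G)) ^ Suc r"
      using bound kgraphD(1)[OF G] E by blast
    moreover have "induced (edges G) (verts G) = edges G"
      using kgraphD(3)[OF G] by (auto simp: induced_def)
    ultimately have le: "real (Suc r) * real r ^ r * real (card (edges G))
        \<le> \<beta> * real (card (verts G)) ^ Suc r" by (simp only:)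
    have r0: "real r ^ r > 0" using r by simp
    have "real (card (edges G)) * fact (Suc r)
        = ?q * (real (Suc r) * real r ^ r * real (card (edges G)))"
      using r0 by (simp add: field_simps)
    also have "\<dots> \<le> ?q * (\<beta> * real (card (verts G)) ^ Suc r)"
      using le q by (intro mult_left_mono) auto
    finally show "real (card (edges G)) * fact (Suc r) \<le> \<beta> * ?q * real (card (verts G)) ^ Suc r"
      by (simp only: mult_ac)
  qed simp
  also have "\<dots> < ?q" using mult_strict_right_mono[OF \<beta>(1) q] by (simp only: mult_1)
  finally show ?thesis .
qed

section \<open>The level construction and the lower bound\<close>

text \<open>A vertex is a triple (level, colour, index).\<close>
definition level_graph :: "nat \<Rightarrow> nat \<Rightarrow> nat \<Rightarrow> (nat \<times> nat \<times> nat) hypergraph" where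
  "level_graph r t s = ({..<t} \<times> {..<r} \<times> {..<s},
    {e. e \<subseteq> {..<t} \<times> {..<r} \<times> {..<s} \<and> card e = Suc r \<and>
      (\<exists>v\<in>e. (\<forall>x\<in>e - {v}. fst v < fst x) \<and> inj_on (\<lambda>x. fst (snd x)) (e - {v}))})"

lemma kgraph_level_graph: "kgraph (Suc r) (level_graph r t s)"
  by (auto simp: kgraph_def level_graph_def)

text \<open>By induction on \<open>h\<close>, a tree vertex with \<open>h\<close> rounds below it
  lies on level at least \<open>h\<close>. The root would thus need level \<open>t\<close>, which
  does not exist.\<close>

lemma level_graph_expansion_tree_free: "\<not> contains_copy (level_graph r t s) (expansion_tree r t)"
proof
  assume "contains_copy (level_graph r t s) (expansion_tree r t)"
  then obtain f where inj: "inj_on f (verts (expansion_tree r t))"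
    and fV: "f ` verts (expansion_tree r t) \<subseteq> {..<t} \<times> {..<r} \<times> {..<s}"
    and fE: "\<And>e. e \<in> edges (expansion_tree r t) \<Longrightarrow> f ` e \<in> edges (level_graph r t s)"
    unfolding contains_copy_def by (auto simp: level_graph_def)
  let ?J = "\<Union> (expansion_edges r)"
  have vert: "p \<in> verts (expansion_tree r t) \<longleftrightarrow> set p \<subseteq> ?J \<and> length p \<le> t" for p
    by (simp add: expansion_tree_def)
  have "h \<le> fst (f p)" if "set p \<subseteq> ?J" "length p + h = t" for h p
    using that
  proof (induction h arbitrary: p)
    case (Suc h)
    have p: "p \<in> verts (expansion_tree r t)" unfolding vert using Suc.prems by simp
    have child: "j # p \<in> verts (expansion_tree r t)" "h \<le> fst (f (j # p))" if "j \<in> ?J" for j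
    proof -
      show "j # p \<in> verts (expansion_tree r t)" unfolding vert using Suc.prems that
        by (simp del: Union_iff)
      show "h \<le> fst (f (j # p))" using Suc.prems that by (intro Suc.IH) (simp_all del: Union_iff)
    qed
    show ?case
    proof (rule ccontr)
      assume "\<not> ?thesis"
      \<comment> \<open>The children of \<open>p\<close> are on levels at least \<open>h\<close>, so
        \<open>p\<close> is the lowest vertex of every edge to its children. The core of the
        expansion then needs \<open>r + 1\<close> distinct colours.\<close>
      then have low: "fst (f p) \<le> h" by simp
      define col where "col a = fst (snd (f ((a, a, 0) # p)))" for a
      have colJ: "(a, a, 0) \<in> ?J" if "a \<le> r" "r > 0" for a
      proof (cases "a < r")
        case True
        then have "expansion_edge r a r \<in> expansion_edges r" by (auto simp: expansion_edges_def)
        then show ?thesis by (rule UnionI) (simp add: expansion_edge_def)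
      next
        case False
        then have "expansion_edge r 0 a \<in> expansion_edges r" using that by (auto simp: expansion_edges_def)
        then show ?thesis by (rule UnionI) (simp add: expansion_edge_def)
      qed
      have diff: "col a \<noteq> col b" if ab: "a < b" "b \<le> r" for a b
      proof -
        let ?e = "expansion_edge r a b"
        have e: "?e \<in> expansion_edges r" using ab by (auto simp: expansion_edges_def)
        have eJ: "?e \<subseteq> ?J" using e by (rule Union_upper)
        have ends: "(a, a, 0) \<in> ?e" "(b, b, 0) \<in> ?e" by (simp_all add: expansion_edge_def)
        have "insert p ((\<lambda>j. j # p) ` ?e) \<in> edges (expansion_tree r t)"
          unfolding expansion_tree_def snd_conv using e Suc.prems
          by (intro CollectI exI[of _ p] exI[of _ ?e]) auto
        from fE[OF this, unfolded level_graph_def snd_conv mem_Collect_eq] obtain v where v: "v \<in> f ` insert p ((\<lambda>j. j # p) ` ?e)"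
          "\<And>x. x \<in> f ` insert p ((\<lambda>j. j # p) ` ?e) - {v} \<Longrightarrow> fst v < fst x"
          "inj_on (\<lambda>x. fst (snd x)) (f ` insert p ((\<lambda>j. j # p) ` ?e) - {v})"
          by blast
        have "v = f p"
        proof (rule ccontr)
          assume "v \<noteq> f p"
          then have "fst v < fst (f p)" by (intro v(2)) auto
          moreover obtain j where "j \<in> ?e" "v = f (j # p)" using v(1) \<open>v \<noteq> f p\<close> by auto
          ultimately show False using child(2)[of j] eJ low by (auto simp del: Union_iff)
        qed
        have mem: "f ((c, c, 0) # p) \<in> f ` insert p ((\<lambda>j. j # p) ` ?e) - {v}" if "(c, c, 0) \<in> ?e" for c
        proof -
          have "(c, c, 0) # p \<in> verts (expansion_tree r t)" using child(1) that eJ by blast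
          then have "f ((c, c, 0) # p) \<noteq> f p" using inj_on_eq_iff[OF inj _ p] by simp
          then show ?thesis using that \<open>v = f p\<close> by auto
        qed
        have "(a, a, 0) # p \<in> verts (expansion_tree r t)" "(b, b, 0) # p \<in> verts (expansion_tree r t)"
          using child(1) ends eJ by blast+
        then have "f ((a, a, 0) # p) \<noteq> f ((b, b, 0) # p)" using inj ab unfolding inj_on_def by auto
        then show ?thesis
          using v(3) mem[OF ends(1)] mem[OF ends(2)] unfolding inj_on_def col_def by blast
      qed
      have "inj_on col {..r}"
      proof (rule inj_onI)
        fix a b assume "a \<in> {..r}" "b \<in> {..r}" "col a = col b"
        then show "a = b" using diff[of a b] diff[of b a] by (cases a b rule: linorder_cases) auto
      qed
      moreover have "r > 0"
      proof -
        have "f p \<in> {..<t} \<times> {..<r} \<times> {..<s}" using fV p by blast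
        then show ?thesis by (auto simp: mem_Times_iff)
      qed
      then have "col ` {..r} \<subseteq> {..<r}"
      proof (intro image_subsetI)
        fix a assume "r > 0" "a \<in> {..r}"
        then have "(a, a, 0) \<in> ?J" by (intro colJ) auto
        from subsetD[OF fV imageI[OF child(1)[OF this]]]
        have "f ((a, a, 0) # p) \<in> {..<t} \<times> {..<r} \<times> {..<s}" .
        then show "col a \<in> {..<r}" by (auto simp: col_def mem_Times_iff)
      qed
      ultimately show False using card_inj_on_le[of col "{..r}" "{..<r}"] by simp
    qed
  qed simp
  from this[of "[]" t] have "t \<le> fst (f [])" by simp
  moreover have "f [] \<in> {..<t} \<times> {..<r} \<times> {..<s}" using fV vert[of "[]"] by auto
  ultimately show False by (auto simp: mem_Times_iff)
qed

text \<open>Choose a lowest vertex of any colour and, for each colour, a vertex on a higher level: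
  with the lowest vertex on level \<open>l\<close> there are
  \<open>r * s * ((t - Suc l) * s) ^ r\<close> choices.\<close>

lemma card_level_graph_ge:
  "r * s ^ Suc r * (\<Sum>j<t. j ^ r) \<le> card (edges (level_graph r t s))"
proof -
  let ?V = "{..<t} \<times> {..<r} \<times> {..<s}"
  define D where "D = (SIGMA v:?V. {..<r} \<rightarrow>\<^sub>E {fst v<..<t} \<times> {..<s})"
  define up where "up g = (\<lambda>c. (fst (g c), c, snd (g c))) ` {..<r}" for g :: "nat \<Rightarrow> nat \<times> nat"
  have lev: "fst v < fst x" if "(v, g) \<in> D" "x \<in> up g" for v g x
    using that by (auto simp: D_def up_def PiE_iff mem_Times_iff)
  have notin: "v \<notin> up g" if "(v, g) \<in> D" for v g
    using lev[OF that, of v] by auto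
  have inj_up: "inj_on (\<lambda>c. (fst (g c), c, snd (g c))) {..<r}" for g :: "nat \<Rightarrow> nat \<times> nat"
    by (auto simp: inj_on_def)
  have into: "(\<lambda>(v, g). insert v (up g)) ` D \<subseteq> edges (level_graph r t s)"
  proof (rule image_subsetI, clarify)
    fix l c i g assume vg: "((l, c, i), g) \<in> D"
    let ?v = "(l, c, i)"
    have "card (up g) = r" using inj_up by (simp add: up_def card_image)
    then have "card (insert ?v (up g)) = Suc r" using notin[OF vg] by (simp add: up_def)
    moreover have "insert ?v (up g) \<subseteq> ?V"
      using vg by (auto simp: D_def up_def PiE_iff mem_Times_iff)
    moreover have "insert ?v (up g) - {?v} = up g" using notin[OF vg] by auto
    moreover have "inj_on (\<lambda>x. fst (snd x)) (up g)" by (auto simp: up_def inj_on_def)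
    ultimately show "insert ?v (up g) \<in> edges (level_graph r t s)"
      using lev[OF vg] unfolding level_graph_def snd_conv
      by (intro CollectI conjI bexI[of _ ?v]) auto
  qed
  have inj: "inj_on (\<lambda>(v, g). insert v (up g)) D"
  proof (rule inj_onI)
    fix x x' assume x: "x \<in> D" "x' \<in> D"
      and eq0: "(case x of (v, g) \<Rightarrow> insert v (up g)) = (case x' of (v, g) \<Rightarrow> insert v (up g))"
    obtain v g where xv: "x = (v, g)" by (cases x)
    obtain v' g' where xv': "x' = (v', g')" by (cases x')
    have vg: "(v, g) \<in> D" and vg': "(v', g') \<in> D" using x by (simp_all only: xv xv')
    have eq: "insert v (up g) = insert v' (up g')" using eq0 by (simp add: xv xv')
    \<comment> \<open>Two different lowest vertices would each be strictly below the other.\<close>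
    have v: "v = v'"
    proof (rule ccontr)
      assume ne: "v \<noteq> v'"
      have "v' \<in> insert v (up g)" unfolding eq by (rule insertI1)
      then have v'_up: "v' \<in> up g" using ne by (metis insertE)
      have "v \<in> insert v' (up g')" unfolding eq[symmetric] by (rule insertI1)
      then have v_up: "v \<in> up g'" using ne by (metis insertE)
      show False using lev[OF vg v'_up] lev[OF vg' v_up] by simp
    qed
    then have up: "up g = up g'" using eq notin[OF vg] notin[OF vg'] by (metis insert_ident)
    \<comment> \<open>The colour \<open>c\<close> of an element of \<open>up g\<close> tells at
      which argument it is the value.\<close>
    have "g = g'"
    proof (rule PiE_ext)
      show "g \<in> {..<r} \<rightarrow>\<^sub>E UNIV" "g' \<in> {..<r} \<rightarrow>\<^sub>E UNIV" using vg vg' by (auto simp: D_def PiE_iff)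
      fix c assume "c \<in> {..<r}"
      then have "(fst (g c), c, snd (g c)) \<in> up g'" unfolding up[symmetric] by (auto simp: up_def)
      then show "g c = g' c" by (auto simp: up_def prod_eq_iff)
    qed
    then show "x = x'" using v xv xv' by simp
  qed
  have "r * s ^ Suc r * (\<Sum>j<t. j ^ r) = (\<Sum>l<t. r * s * ((t - Suc l) * s) ^ r)"
    using sum.nat_diff_reindex[of "\<lambda>j. r * s * (j * s) ^ r" t]
    by (simp add: sum_distrib_left power_mult_distrib mult_ac)
  also have "\<dots> = (\<Sum>l<t. \<Sum>y\<in>{..<r} \<times> {..<s}. ((t - Suc l) * s) ^ r)"
    by (simp add: card_cartesian_product)
  also have "\<dots> = (\<Sum>v\<in>?V. ((t - Suc (fst v)) * s) ^ r)"
    by (simp only: sum.cartesian_product split_def)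
  also have "\<dots> = card D"
    unfolding D_def by (subst card_SigmaI) (auto simp: card_PiE card_cartesian_product intro!: finite_PiE)
  also have "\<dots> = card ((\<lambda>(v, g). insert v (up g)) ` D)" using card_image[OF inj] by simp
  also have "\<dots> \<le> card (edges (level_graph r t s))"
    by (rule card_mono[OF kgraphD(2)[OF kgraph_level_graph] into])
  finally show ?thesis .
qed

lemma power_Suc_diff_le: "Suc n ^ Suc r \<le> n ^ Suc r + Suc r * Suc n ^ r"
proof (induction r)
  case (Suc r)
  have "Suc n ^ Suc (Suc r) \<le> Suc n * (n ^ Suc r + Suc r * Suc n ^ r)"
    using mult_le_mono2[OF Suc, of "Suc n"] by simp
  also have "\<dots> = n ^ Suc (Suc r) + n ^ Suc r + Suc r * Suc n ^ Suc r" by (simp add: algebra_simps)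
  also have "n ^ Suc r \<le> Suc n ^ Suc r" by (rule power_mono) auto
  finally show ?case by simp
qed simp

text \<open>Telescoping of \<open>power_Suc_diff_le\<close>, a discrete form of the integral of
  \<open>x ^ r\<close>. The sum ends at \<open>j = t - 1\<close>, whence the base on the
  left.\<close>

lemma power_le_sum_powers: "(t - 1) ^ Suc r \<le> Suc r * (\<Sum>j<t. j ^ r)"
proof (induction t)
  case (Suc t)
  show ?case
  proof (cases t)
    case (Suc m)
    have "t ^ Suc r \<le> (t - 1) ^ Suc r + Suc r * t ^ r" using power_Suc_diff_le[of m r] Suc by simp
    also have "\<dots> \<le> Suc r * (\<Sum>j<t. j ^ r) + Suc r * t ^ r" using Suc.IH by simp
    finally show ?thesis by (simp add: distrib_left)
  qed simp
qed simp

text \<open>For fixed \<open>t\<close>, every \<open>level_graph r t s\<close> is free of the tree,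
  so its edge density bounds the limit along the subsequence \<open>n = t * r * s\<close> from
  below.\<close>

lemma turan_density_expansion_tree_ge:
  assumes r: "r \<ge> 2" and t: "t > 0"
  shows "fact r / real r ^ r * (real (t - 1) / real t) ^ Suc r
    \<le> turan_density (Suc r) (expansion_tree r t)"
proof -
  let ?F = "expansion_tree r t"
  let ?f = "\<lambda>n. real (ex_number (Suc r) n ?F) / real (n choose Suc r)"
  have sub: "\<And>e. e \<in> edges ?F \<Longrightarrow> e \<subseteq> verts ?F"
    by (rule kgraphD(3)[OF kgraph_expansion_tree[OF r]])
  have lim: "?f \<longlonglongrightarrow> turan_density (Suc r) ?F"
    by (rule turan_density_LIMSEQ[OF expansion_tree_edges_nonempty[OF r t] sub])
  have tr: "t * r > 0" using r t by simp
  have "strict_mono (\<lambda>s. t * r * s)" using tr by (intro strict_monoI) simp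
  from LIMSEQ_subseq_LIMSEQ[OF lim this]
  have lim': "(\<lambda>s. ?f (t * r * s)) \<longlonglongrightarrow> turan_density (Suc r) ?F" by (simp add: o_def)
  have "fact r / real r ^ r * (real (t - 1) / real t) ^ Suc r \<le> ?f (t * r * s)"
    if s: "s \<ge> Suc r" for s
  proof -
    let ?n = "t * r * s"
    have "card (verts (level_graph r t s)) = ?n"
      by (simp add: level_graph_def card_cartesian_product)
    then have "card (edges (level_graph r t s)) \<le> ex_number (Suc r) ?n ?F"
      using le_ex_number[OF kgraph_level_graph[of r t s] level_graph_expansion_tree_free sub]
      by (simp only:)
    then have "r * s ^ Suc r * (\<Sum>j<t. j ^ r) \<le> ex_number (Suc r) ?n ?F"
      using card_level_graph_ge le_trans by blast
    then have "Suc r * (r * s ^ Suc r * (\<Sum>j<t. j ^ r)) \<le> Suc r * ex_number (Suc r) ?n ?F"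
      by (rule mult_le_mono2)
    moreover have "r * s ^ Suc r * (t - 1) ^ Suc r \<le> Suc r * (r * s ^ Suc r * (\<Sum>j<t. j ^ r))"
      using mult_le_mono2[OF power_le_sum_powers[of t r], of "r * s ^ Suc r"] by (simp only: mult_ac)
    ultimately have "r * s ^ Suc r * (t - 1) ^ Suc r \<le> Suc r * ex_number (Suc r) ?n ?F"
      by linarith
    from of_nat_mono[OF this, where 'a = real]
    have low: "real r * real s ^ Suc r * real (t - 1) ^ Suc r
        \<le> real (Suc r) * real (ex_number (Suc r) ?n ?F)"
      unfolding of_nat_mult of_nat_power .
    \<comment> \<open>The restriction \<open>s \<ge> Suc r\<close> keeps the binomial in the
      denominator positive.\<close>
    have "Suc r \<le> ?n" using s tr by (metis le_trans mult_le_mono1 nat_mult_1 Suc_leI One_nat_def)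
    then have pos: "real (?n choose Suc r) > 0" by simp
    have "real (?n choose Suc r) * fact (Suc r) \<le> real ?n ^ Suc r"
      using binomial_fact_pow[of ?n "Suc r"]
      by (metis of_nat_fact of_nat_le_iff of_nat_mult of_nat_power)
    then have up: "real (?n choose Suc r) * (real (Suc r) * fact r) \<le> real ?n ^ Suc r"
      by (simp only: fact_Suc of_nat_id)
    let ?x = "(real (t - 1) / real t) ^ Suc r" and ?X = "real (ex_number (Suc r) ?n ?F)"
    have nz: "real t > 0" "real r > 0" "real s > 0" using r t s by auto
    have n_pow: "real ?n ^ Suc r = real t ^ Suc r * (real r ^ r * (real r * real s ^ Suc r))"
      by (simp add: power_mult_distrib mult_ac)
    \<comment> \<open>Scaling by \<open>real (Suc r) * real ?n ^ Suc r\<close> lets the upper bound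
      on the binomial and the lower bound on the edges combine without division by either.\<close>
    have "(fact r / real r ^ r * ?x * real (?n choose Suc r)) * (real (Suc r) * real ?n ^ Suc r)
      = (real (?n choose Suc r) * (real (Suc r) * fact r)) * (?x / real r ^ r * real ?n ^ Suc r)"
      by (simp add: mult_ac)
    also have "\<dots> \<le> real ?n ^ Suc r * (?x / real r ^ r * real ?n ^ Suc r)"
      using up by (intro mult_right_mono) auto
    also have "?x / real r ^ r * real ?n ^ Suc r = real r * real s ^ Suc r * real (t - 1) ^ Suc r"
      unfolding n_pow power_divide using nz by (simp add: field_simps)
    also have "real ?n ^ Suc r * \<dots> \<le> real ?n ^ Suc r * (real (Suc r) * ?X)"
      using low by (intro mult_left_mono) auto
    also have "\<dots> = ?X * (real (Suc r) * real ?n ^ Suc r)" by (simp only: mult_ac)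
    finally have "fact r / real r ^ r * ?x * real (?n choose Suc r) \<le> ?X"
    proof (rule mult_right_le_imp_le)
      show "0 < real (Suc r) * real ?n ^ Suc r" using nz by simp
    qed
    then show ?thesis using pos by (simp only: pos_le_divide_eq)
  qed
  then show ?thesis using LIMSEQ_le_const[OF lim'] by blast
qed

section \<open>The accumulation point\<close>

lemma islimpt_turan_densities:
  assumes r: "r \<ge> 2"
  shows "(fact r / real r ^ r) islimpt turan_densities (Suc r)"
  unfolding islimpt_approachable
proof (intro allI impI)
  let ?q = "fact r / real r ^ r"
  fix \<epsilon> :: real assume \<epsilon>: "\<epsilon> > 0"
  have "(\<lambda>t. 1 - 1 / real t) \<longlonglongrightarrow> 1 - 0"
    by (intro tendsto_diff tendsto_const lim_const_over_n)
  then have "(\<lambda>t. ?q * (1 - 1 / real t) ^ Suc r) \<longlonglongrightarrow> ?q * (1 - 0) ^ Suc r"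
    by (intro tendsto_mult tendsto_power tendsto_const)
  then have "(\<lambda>t. ?q * (1 - 1 / real t) ^ Suc r) \<longlonglongrightarrow> ?q" by simp
  then have "\<forall>\<^sub>F t in sequentially. ?q - \<epsilon> < ?q * (1 - 1 / real t) ^ Suc r"
    using \<epsilon> by (intro order_tendstoD(1)) auto
  then have "\<forall>\<^sub>F t in sequentially. t > 0 \<and> ?q - \<epsilon> < ?q * (1 - 1 / real t) ^ Suc r"
    using eventually_gt_at_top[of 0] by eventually_elim auto
  then obtain t where t: "t > 0" "?q - \<epsilon> < ?q * (1 - 1 / real t) ^ Suc r"
    using eventually_happens'[OF sequentially_bot] by blast
  let ?F = "expansion_tree r t"
  let ?p = "turan_density (Suc r) ?F"
  have "1 - 1 / real t = real (t - 1) / real t" using t(1) by (simp add: field_simps of_nat_diff)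
  then have "?q - \<epsilon> < ?p" using t turan_density_expansion_tree_ge[OF r t(1)] by simp
  \<comment> \<open>Strictness makes this density different from \<open>?q\<close>.\<close>
  moreover have "?p < ?q" by (rule turan_density_expansion_tree_less[OF r t(1)])
  moreover have "?p \<in> turan_densities (Suc r)"
  proof -
    let ?g = "to_nat :: expansion_vertex list \<Rightarrow> nat"
    have F: "kgraph (Suc r) ?F" by (rule kgraph_expansion_tree[OF r])
    have "kgraph (Suc r) (?g ` verts ?F, (`) ?g ` edges ?F)"
      using F inj_on_subset[OF inj_to_nat] unfolding kgraph_def
      by (auto simp: card_image)
    moreover have "turan_density (Suc r) (?g ` verts ?F, (`) ?g ` edges ?F) = ?p"
      by (rule turan_density_image[OF inj_to_nat kgraphD(3)[OF F]])
    ultimately show ?thesis unfolding turan_densities_def by force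
  qed
  ultimately show "\<exists>x\<in>turan_densities (Suc r). x \<noteq> ?q \<and> dist x ?q < \<epsilon>"
    by (intro bexI[of _ ?p]) (auto simp: dist_real_def)
qed

theorem theorem1p1:
  shows "(\<forall>k\<ge>3. \<exists>x\<in>{0..<1}. x islimpt turan_densities k) \<and>
         (1 / 2) islimpt turan_densities 3"
proof (intro conjI allI impI)
  fix k :: nat assume "k \<ge> 3"
  then obtain r where k: "k = Suc r" and r: "r \<ge> 2" by (cases k) auto
  \<comment> \<open>The factor 1 of the factorial is dropped, leaving \<open>m\<close> factors of at
    most \<open>Suc m\<close>. Hence \<open>fact r < r ^ r\<close>, and the accumulation point lies
    below 1.\<close>
  have "fact (Suc m) \<le> Suc m ^ m" for m :: nat
  proof (induction m)
    case (Suc m)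
    have "fact (Suc (Suc m)) \<le> Suc (Suc m) * Suc m ^ m"
      using mult_le_mono2[OF Suc, of "Suc (Suc m)"] by (simp only: fact_Suc of_nat_id)
    also have "\<dots> \<le> Suc (Suc m) * Suc (Suc m) ^ m" by (intro mult_le_mono2 power_mono) auto
    finally show ?case by simp
  qed simp
  from this[of "r - 1"] have "fact r \<le> r ^ (r - 1)" using r by simp
  also have "\<dots> < r ^ r" using r by (intro power_strict_increasing) auto
  finally have "real (fact r) < real (r ^ r)" by (simp only: of_nat_less_iff)
  then have "fact r / real r ^ r < 1" using r by simp
  then show "\<exists>x\<in>{0..<1}. x islimpt turan_densities k"
    using islimpt_turan_densities[OF r] k by (intro bexI[of _ "fact r / real r ^ r"]) auto
next
  \<comment> \<open>For \<open>r = 2\<close> the value is \<open>2 / 2 ^ 2\<close>.\<close>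
  show "(1 / 2) islimpt turan_densities 3"
    using islimpt_turan_densities[of 2] by (simp add: numeral_3_eq_3 fact_numeral)
qed

end
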